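(* Every planar $3$-tree has track number at most $25$.
   Context: A $k$-tree is defined recursively: the complete graph $K_k$ is a $k$-tree, and adding to a $k$-tree a new vertex adjacent to all vertices of some $k$-clique yields a $k$-tree; a planar $3$-tree is a $3$-tree that is planar. A $t$-track assignment of a graph $G$ is a partition of $V(G)$ into $t$ sets $V_1,\dots,V_t$ (tracks), each an independent set of $G$, together with a total order $<_i$ on each $V_i$. An X-crossing consists of two edges $(u,v)$ and $(x,y)$ with $u,x\in V_i$, $v,y\in V_j$ ($i\neq j$), $u<_i x$ and $y<_j v$. A $t$-track layout is a $t$-track assignment with no X-crossing; the track number $\mathrm{tn}(G)$ is the minimum $t$ for which $G$ has a $t$-track layout. *)

theory Defs
  imports "HOL-Analysis.Analysis"
begin

text \<open>Simple graphs: a vertex set V and a set E of 2-element subsets of V.\<close>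

definition clique_edges :: "'a set \<Rightarrow> 'a set set" where
  "clique_edges C = {e. e \<subseteq> C \<and> card e = 2}"

inductive ktree :: "nat \<Rightarrow> 'a set \<Rightarrow> 'a set set \<Rightarrow> bool" for k :: nat where
  base: "finite V \<Longrightarrow> card V = k \<Longrightarrow> ktree k V (clique_edges V)"
| step: "ktree k V E \<Longrightarrow> v \<notin> V \<Longrightarrow> C \<subseteq> V \<Longrightarrow> card C = k \<Longrightarrow>
         clique_edges C \<subseteq> E \<Longrightarrow>
         ktree k (insert v V) (E \<union> {{v, c} | c. c \<in> C})"

definition planar :: "'a set \<Rightarrow> 'a set set \<Rightarrow> bool" where
  "planar V E \<longleftrightarrow> (\<exists>(p :: 'a \<Rightarrow> complex) (\<gamma> :: 'a set \<Rightarrow> real \<Rightarrow> complex).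
     inj_on p V \<and>
     (\<forall>e\<in>E. arc (\<gamma> e) \<and> {pathstart (\<gamma> e), pathfinish (\<gamma> e)} = p ` e) \<and>
     (\<forall>e\<in>E. \<forall>v\<in>V - e. p v \<notin> path_image (\<gamma> e)) \<and>
     (\<forall>e\<in>E. \<forall>e'\<in>E. e \<noteq> e' \<longrightarrow> path_image (\<gamma> e) \<inter> path_image (\<gamma> e') \<subseteq> p ` (e \<inter> e')))"

definition planar_ktree :: "nat \<Rightarrow> 'a set \<Rightarrow> 'a set set \<Rightarrow> bool" where
  "planar_ktree k V E \<longleftrightarrow> ktree k V E \<and> planar V E"

definition track_assignment ::
  "'a set \<Rightarrow> 'a set set \<Rightarrow> nat \<Rightarrow> ('a \<Rightarrow> nat) \<Rightarrow> (nat \<Rightarrow> 'a rel) \<Rightarrow> bool" where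
  "track_assignment V E t tr ord \<longleftrightarrow>
     (\<forall>v\<in>V. tr v < t) \<and>
     (\<forall>u v. {u, v} \<in> E \<longrightarrow> tr u \<noteq> tr v) \<and>
     (\<forall>i<t. strict_linear_order_on {v\<in>V. tr v = i} (ord i))"

definition x_crossing ::
  "'a set set \<Rightarrow> ('a \<Rightarrow> nat) \<Rightarrow> (nat \<Rightarrow> 'a rel) \<Rightarrow> bool" where
  "x_crossing E tr ord \<longleftrightarrow>
     (\<exists>u v x y. {u, v} \<in> E \<and> {x, y} \<in> E \<and> tr u = tr x \<and> tr v = tr y \<and> tr u \<noteq> tr v \<and>
        (u, x) \<in> ord (tr u) \<and> (y, v) \<in> ord (tr v))"

definition track_layout ::
  "'a set \<Rightarrow> 'a set set \<Rightarrow> nat \<Rightarrow> ('a \<Rightarrow> nat) \<Rightarrow> (nat \<Rightarrow> 'a rel) \<Rightarrow> bool" where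
  "track_layout V E t tr ord \<longleftrightarrow> track_assignment V E t tr ord \<and> \<not> x_crossing E tr ord"

definition track_number :: "'a set \<Rightarrow> 'a set set \<Rightarrow> nat" where
  "track_number V E = (LEAST t. \<exists>tr ord. track_layout V E t tr ord)"

end

theory Submission
  imports Defs
begin

text \<open>
  Planarity is used only through \<open>K\<^sub>3\<^sub>,\<^sub>3\<close>: no 3-clique has three common neighbours, so apart from the
  base every 3-clique receives at most one further vertex.

  Partition the vertices by breadth-first depth and connectivity into bags. The neighbours of a bag at the
  previous depth lie on one triangle of its parent bag, and every bag is outerplanar. A bag is drawn on
  integer levels such that each edge has span 1 or 2, each triangle occupies three consecutive levels,
  no two edges cross, and the triangles are linearly ordered from left to right consistently with all levels.
  Each clique that can still be extended owns a gap of the drawing, and filling a gap splits it into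
  disjoint gaps for the new cliques.

  The levels wrap modulo 5. After wrapping, the triangles fall into two colour classes that are still linearly
  ordered. A child bag is placed 1 or 2 units after its parent, according to the colour of its
  triangle, and these positions again wrap modulo 5, giving 25 tracks.
\<close>

text \<open>The 5 comes from the spans. An edge inside a bag (in levels) and an edge from a bag to a
  child (in bag positions) has signed span -2, -1, 1 or 2, and these are distinct and nonzero modulo
  5. Two edges on the same pair of tracks therefore have the same signed span before wrapping, and
  since tracks compare unwrapped positions first, a crossing would have to exist already between two
  unwrapped layers.

  The obstacle is the edges to child bags. A child sees a whole triangle, whose corners lie on
  different levels, so a single order of the children must agree with the order of the corners on
  every level. Before wrapping, the positions of the triangles supply it. Wrapping adds comparisons
  between triangles at different heights, and these may make the order cyclic. Within one colour
  class this cannot happen, and using the colour as the distance from parent to child lets the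
  tracks of an edge reveal it, so that only triangles of one colour are ever compared.\<close>

subsection \<open>Drawings of bags\<close>

type_synonym point = "nat \<times> real"
type_synonym gap = "point set \<times> real \<times> real"

text \<open>A point is a pair of a level and an abscissa. A gap \<open>(S, lo, hi)\<close> is an empty interval reserved
  for a future vertex whose older neighbours in the same bag lie at \<open>S\<close>, and for everything
  that is later hung from that vertex.\<close>

definition above :: "point set \<Rightarrow> nat \<Rightarrow> bool" where
  "above S n \<longleftrightarrow> S = {} \<or> (\<exists>s\<in>S. fst s < n)"

text \<open>\<open>compat g p y\<close>: joining \<open>p\<close> to something at abscissa \<open>y\<close> does not interfere with filling \<open>g\<close>.
  The region above a gap acts as a wall for everything above the lowest point of \<open>S\<close>,
  which is what the second conjunct says.\<close>

definition compat :: "gap \<Rightarrow> point \<Rightarrow> real \<Rightarrow> bool" where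
  "compat g p y \<longleftrightarrow> (case g of (S, lo, hi) \<Rightarrow>
     (\<forall>s\<in>S. fst p = fst s \<longrightarrow> (snd p < snd s \<longrightarrow> y \<le> lo) \<and> (snd s < snd p \<longrightarrow> hi \<le> y)) \<and>
     (above S (fst p) \<longrightarrow> (snd p \<le> lo \<longleftrightarrow> y \<le> lo)))"

text \<open>\<open>P\<close>, \<open>T\<close> and \<open>E\<close> are the points, gaps and edges of a bag. \<open>(p, k) \<in> K\<close> says that \<open>p\<close> is a corner of a
  triangle of the bag whose position among all triangles is \<open>k\<close>.\<close>

definition good ::
  "point set \<Rightarrow> gap set \<Rightarrow> (point \<times> point) set \<Rightarrow> (point \<times> real) set \<Rightarrow> bool" where
  "good P T E K \<longleftrightarrow>
     (\<forall>(S, lo, hi)\<in>T. S \<subseteq> P \<and> lo < hi \<and> (\<forall>p\<in>P. snd p \<le> lo \<or> hi \<le> snd p)) \<and>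
     (\<forall>(p, q)\<in>E. p \<in> P \<and> q \<in> P \<and> (q, p) \<in> E) \<and>
     (\<forall>(p, k)\<in>K. p \<in> P \<and> k \<in> snd ` P) \<and>
     (\<forall>(S, lo, hi)\<in>T. \<forall>(S', lo', hi')\<in>T. (S, lo, hi) \<noteq> (S', lo', hi') \<longrightarrow>
        (hi \<le> lo' \<or> hi' \<le> lo) \<and>
        (\<forall>s\<in>S'. \<forall>y. lo' < y \<and> y < hi' \<longrightarrow> compat (S, lo, hi) s y)) \<and>
     (\<forall>(S, lo, hi)\<in>T. \<forall>(p, q)\<in>E. above S (fst q) \<longrightarrow> compat (S, lo, hi) p (snd q)) \<and>
     (\<forall>g\<in>T. \<forall>(p, k)\<in>K. compat g p k) \<and>
     (\<forall>(p, q)\<in>E. \<forall>(p', q')\<in>E. fst p = fst p' \<and> fst q = fst q' \<and> snd p < snd p' \<longrightarrow> snd q \<le> snd q') \<and>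
     (\<forall>(p, k)\<in>K. \<forall>(p', k')\<in>K. fst p = fst p' \<and> snd p < snd p' \<longrightarrow> k < k')"

lemma goodD:
  assumes "good P T E K"
  shows good_gap: "(S, lo, hi) \<in> T \<Longrightarrow> S \<subseteq> P \<and> lo < hi"
    and good_gap_free: "(S, lo, hi) \<in> T \<Longrightarrow> p \<in> P \<Longrightarrow> snd p \<le> lo \<or> hi \<le> snd p"
    and good_edge: "(p, q) \<in> E \<Longrightarrow> p \<in> P \<and> q \<in> P \<and> (q, p) \<in> E"
    and good_mark: "(p, k) \<in> K \<Longrightarrow> p \<in> P \<and> k \<in> snd ` P"
    and good_gaps_disjoint: "(S, lo, hi) \<in> T \<Longrightarrow> (S', lo', hi') \<in> T \<Longrightarrow> (S, lo, hi) \<noteq> (S', lo', hi') \<Longrightarrow>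
          hi \<le> lo' \<or> hi' \<le> lo"
    and good_gap_gap: "(S, lo, hi) \<in> T \<Longrightarrow> (S', lo', hi') \<in> T \<Longrightarrow> (S, lo, hi) \<noteq> (S', lo', hi') \<Longrightarrow>
          s \<in> S' \<Longrightarrow> lo' < y \<Longrightarrow> y < hi' \<Longrightarrow> compat (S, lo, hi) s y"
    and good_gap_edge: "(S, lo, hi) \<in> T \<Longrightarrow> (p, q) \<in> E \<Longrightarrow> above S (fst q) \<Longrightarrow> compat (S, lo, hi) p (snd q)"
    and good_gap_mark: "g \<in> T \<Longrightarrow> (p, k) \<in> K \<Longrightarrow> compat g p k"
    and good_edge_edge: "(p, q) \<in> E \<Longrightarrow> (p', q') \<in> E \<Longrightarrow> fst p = fst p' \<Longrightarrow> fst q = fst q' \<Longrightarrow>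
          snd p < snd p' \<Longrightarrow> snd q \<le> snd q'"
    and good_mark_mark: "(p, k) \<in> K \<Longrightarrow> (p', k') \<in> K \<Longrightarrow> fst p = fst p' \<Longrightarrow> snd p < snd p' \<Longrightarrow> k < k'"
proof -
  note A = assms[unfolded good_def]
  show "(S, lo, hi) \<in> T \<Longrightarrow> S \<subseteq> P \<and> lo < hi"
    using conjunct1[OF A] by fast
  show "(S, lo, hi) \<in> T \<Longrightarrow> p \<in> P \<Longrightarrow> snd p \<le> lo \<or> hi \<le> snd p"
    using conjunct1[OF A] by fast
  note A = conjunct2[OF A]
  show "(p, q) \<in> E \<Longrightarrow> p \<in> P \<and> q \<in> P \<and> (q, p) \<in> E"
    using conjunct1[OF A] by fast
  note A = conjunct2[OF A]
  show "(p, k) \<in> K \<Longrightarrow> p \<in> P \<and> k \<in> snd ` P"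
    using conjunct1[OF A] by fast
  note A = conjunct2[OF A]
  show "(S, lo, hi) \<in> T \<Longrightarrow> (S', lo', hi') \<in> T \<Longrightarrow> (S, lo, hi) \<noteq> (S', lo', hi') \<Longrightarrow> hi \<le> lo' \<or> hi' \<le> lo"
    using conjunct1[OF A] by fast
  show "(S, lo, hi) \<in> T \<Longrightarrow> (S', lo', hi') \<in> T \<Longrightarrow> (S, lo, hi) \<noteq> (S', lo', hi') \<Longrightarrow>
          s \<in> S' \<Longrightarrow> lo' < y \<Longrightarrow> y < hi' \<Longrightarrow> compat (S, lo, hi) s y"
    using conjunct1[OF A] by fast
  note A = conjunct2[OF A]
  show "(S, lo, hi) \<in> T \<Longrightarrow> (p, q) \<in> E \<Longrightarrow> above S (fst q) \<Longrightarrow> compat (S, lo, hi) p (snd q)"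
    using conjunct1[OF A] by fast
  note A = conjunct2[OF A]
  show "g \<in> T \<Longrightarrow> (p, k) \<in> K \<Longrightarrow> compat g p k"
    using conjunct1[OF A] by fast
  note A = conjunct2[OF A]
  show "(p, q) \<in> E \<Longrightarrow> (p', q') \<in> E \<Longrightarrow> fst p = fst p' \<Longrightarrow> fst q = fst q' \<Longrightarrow>
          snd p < snd p' \<Longrightarrow> snd q \<le> snd q'"
    using conjunct1[OF A] by fast
  note A = conjunct2[OF A]
  show "(p, k) \<in> K \<Longrightarrow> (p', k') \<in> K \<Longrightarrow> fst p = fst p' \<Longrightarrow> snd p < snd p' \<Longrightarrow> k < k'"
    using A by fast
qed

text \<open>Filling the gap \<open>g\<close> with the point \<open>w\<close> leaves the gaps \<open>N\<close>.\<close>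

definition splits :: "gap \<Rightarrow> point \<Rightarrow> gap set \<Rightarrow> bool" where
  "splits g w N \<longleftrightarrow> (case g of (S, lo, hi) \<Rightarrow>
     lo < snd w \<and> snd w < hi \<and> above S (fst w) \<and> inj_on fst S \<and> fst w \<notin> fst ` S \<and>
     (\<forall>(S', lo', hi')\<in>N. lo \<le> lo' \<and> lo' < hi' \<and> hi' \<le> hi \<and> (snd w \<le> lo' \<or> hi' \<le> snd w) \<and>
        S' \<subseteq> insert w S \<and> (\<forall>m. above S' m \<longrightarrow> above S m) \<and>
        (\<forall>p\<in>insert w S. above S' (fst p) \<longrightarrow> (snd p \<le> lo' \<longleftrightarrow> snd w \<le> lo')) \<and>
        (\<forall>(S2, lo2, hi2)\<in>N. (S', lo', hi') \<noteq> (S2, lo2, hi2) \<longrightarrow> (hi' \<le> lo2 \<or> hi2 \<le> lo') \<and>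
           (\<forall>p\<in>S2. above S' (fst p) \<longrightarrow> (snd p \<le> lo' \<longleftrightarrow> hi2 \<le> lo')))))"

lemma ball_pair: "(\<forall>(p, q)\<in>A. Q p q) \<longleftrightarrow> (\<forall>p q. (p, q) \<in> A \<longrightarrow> Q p q)"
  by auto

lemma ball_triple: "(\<forall>(p, q, r)\<in>A. Q p q r) \<longleftrightarrow> (\<forall>p q r. (p, q, r) \<in> A \<longrightarrow> Q p q r)"
  by auto

text \<open>The interval was empty, so only compatibility has to be rechecked, and four facts cover
  it. What lies outside the old gap and was compatible with it is compatible with its parts
  (\<open>sub\<close>). A gap elsewhere tolerates anything going from \<open>insert w S\<close> into
  the old gap (\<open>out\<close>), and also the reverse edges from \<open>w\<close>
  (\<open>bck\<close>). Between the new gaps and \<open>insert w S\<close> the wall conditions of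
  \<open>splits\<close> decide (\<open>inn\<close>).\<close>

lemma good_split:
  assumes G: "good P T E K" and tau: "(S, lo, hi) \<in> T" and sp: "splits (S, lo, hi) w N"
  shows "good (insert w P) (T - {(S, lo, hi)} \<union> N) (E \<union> {(s, w) |s. s \<in> S} \<union> {(w, s) |s. s \<in> S})
           (K \<union> {(p, snd w) |p. p \<in> insert w S})"
proof -
  obtain n z where w: "w = (n, z)" by fastforce
  note sp' = sp[unfolded splits_def prod.case]
  have z: "lo < z" "z < hi" and an: "above S n" and inj: "inj_on fst S" and nS: "n \<notin> fst ` S"
    using sp' by (simp_all add: w)
  note B = bspec[OF conjunct2[OF conjunct2[OF conjunct2[OF conjunct2[OF conjunct2[OF sp']]]]], unfolded prod.case]
  have sw: "snd w = z" by (simp add: w)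
  have N1: "lo \<le> lo' \<and> lo' < hi' \<and> hi' \<le> hi \<and> (z \<le> lo' \<or> hi' \<le> z) \<and> S' \<subseteq> insert w S \<and>
      (\<forall>m. above S' m \<longrightarrow> above S m)" if "(S', lo', hi') \<in> N" for S' lo' hi'
    using B[OF that, unfolded prod.case sw] by (elim conjE) (intro conjI)
  have N2: "snd p \<le> lo' \<longleftrightarrow> z \<le> lo'" if "(S', lo', hi') \<in> N" "p \<in> insert w S" "above S' (fst p)"
    for S' lo' hi' p
  proof -
    note B1 = B[OF that(1), unfolded prod.case sw, THEN conjunct2, THEN conjunct2, THEN conjunct2,
      THEN conjunct2, THEN conjunct2, THEN conjunct2, THEN conjunct1]
    show ?thesis using bspec[OF B1 that(2)] that(3) by (rule mp)
  qed
  have N3: "(hi' \<le> lo2 \<or> hi2 \<le> lo') \<and> (\<forall>p\<in>S2. above S' (fst p) \<longrightarrow> (snd p \<le> lo' \<longleftrightarrow> hi2 \<le> lo'))"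
    if "(S', lo', hi') \<in> N" "(S2, lo2, hi2) \<in> N" "(S', lo', hi') \<noteq> (S2, lo2, hi2)"
    for S' lo' hi' S2 lo2 hi2
  proof -
    note B2 = B[OF that(1), unfolded prod.case, THEN conjunct2, THEN conjunct2, THEN conjunct2,
      THEN conjunct2, THEN conjunct2, THEN conjunct2, THEN conjunct2]
    show ?thesis using bspec[OF B2 that(2), unfolded prod.case] that(3) by (rule mp)
  qed
  have SP: "S \<subseteq> P" using good_gap[OF G tau] by simp
  have gf: "snd p \<le> lo \<or> hi \<le> snd p" if "p \<in> P" for p using good_gap_free[OF G tau that] .
  let ?E = "E \<union> {(s, w) |s. s \<in> S} \<union> {(w, s) |s. s \<in> S}"
  let ?K = "K \<union> {(p, snd w) |p. p \<in> insert w S}"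
  have sub: "compat (S', lo', hi') p y"
    if c: "compat (S, lo, hi) p y" and nu: "(S', lo', hi') \<in> N" and p: "p \<in> P" and y: "y \<le> lo \<or> hi \<le> y"
    for S' lo' hi' p y
  proof -
    have a: "lo \<le> lo'" "lo' < hi'" "hi' \<le> hi" "S' \<subseteq> insert w S" "\<And>m. above S' m \<Longrightarrow> above S m"
      using N1[OF nu] by auto
    show ?thesis unfolding compat_def prod.case
    proof (intro conjI ballI impI)
      fix s assume s: "s \<in> S'" "fst p = fst s"
      { assume lt: "snd p < snd s"
        show "y \<le> lo'"
        proof (cases "s = w")
          \<comment> \<open>\<open>S'\<close> may contain \<open>w\<close>, about which the old gap
            says nothing directly. But the level of \<open>w\<close> is above \<open>S\<close>, so
            the wall of the old gap decides the side.\<close>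
          case True
          then have "snd p \<le> lo" using gf[OF p] z lt w by auto
          then have "y \<le> lo" using c an s True w unfolding compat_def by auto
          then show ?thesis using a by simp
        next
          case False
          then have "s \<in> S" using s a by auto
          then have "y \<le> lo" using c s lt unfolding compat_def by auto
          then show ?thesis using a by simp
        qed }
      { assume lt: "snd s < snd p"
        show "hi' \<le> y"
        proof (cases "s = w")
          case True
          then have "\<not> snd p \<le> lo" using z lt w by auto
          then have "\<not> y \<le> lo" using c an s True w unfolding compat_def by auto
          then show ?thesis using a y by simp
        next
          case False
          then have "s \<in> S" using s a by auto
          then have "hi \<le> y" using c s lt unfolding compat_def by auto
          then show ?thesis using a by simp
        qed }
    next
      assume "above S' (fst p)"
      then have "above S (fst p)" using a by auto
      then have "snd p \<le> lo \<longleftrightarrow> y \<le> lo" using c unfolding compat_def by auto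
      then show "snd p \<le> lo' \<longleftrightarrow> y \<le> lo'" using gf[OF p] y a by linarith
    qed
  qed
  have out: "compat (S', lo', hi') p y"
    if nu: "(S', lo', hi') \<in> T" "(S', lo', hi') \<noteq> (S, lo, hi)" and p: "p \<in> insert w S" and y: "lo < y" "y < hi"
    for S' lo' hi' p y
  proof (cases "p = w")
    case False
    then show ?thesis using good_gap_gap[OF G nu(1) tau nu(2)] p y by blast
  next
    case True
    have d: "hi' \<le> lo \<or> hi \<le> lo'" using good_gaps_disjoint[OF G nu(1) tau nu(2)] .
    have S'P: "S' \<subseteq> P" and l': "lo' < hi'" using good_gap[OF G nu(1)] by auto
    \<comment> \<open>\<open>good_gap_gap\<close> speaks of abscissae strictly inside the other gap;
      the midpoint stands for that gap.\<close>
    define y' where "y' = (lo' + hi') / 2"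
    have y': "lo' < y'" "y' < hi'" using l' by (auto simp: y'_def)
    have key: "snd s \<le> lo \<longleftrightarrow> y' \<le> lo" if "s \<in> S'" "fst s = n" for s
      using good_gap_gap[OF G tau nu(1) nu(2)[symmetric] that(1) y'] an that unfolding compat_def by simp
    show ?thesis unfolding compat_def prod.case True w fst_conv snd_conv
    proof (intro conjI ballI impI)
      fix s assume s: "s \<in> S'" "n = fst s"
      { assume "z < snd s"
        then show "y \<le> lo'" using key[of s] s gf[of s] S'P z y y' d by fastforce }
      { assume "snd s < z"
        then show "hi' \<le> y" using key[of s] s gf[of s] S'P z y y' d by fastforce }
    next
      show "z \<le> lo' \<longleftrightarrow> y \<le> lo'" using d z y l' by linarith
    qed
  qed
  have inSw: "s = s'" if "s \<in> insert w S" "s' \<in> insert w S" "fst s = fst s'" for s s'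
  proof -
    have "inj_on fst (insert w S)" using inj nS unfolding inj_on_insert w fst_conv by blast
    then show ?thesis using inj_onD that by metis
  qed
  \<comment> \<open>The points of \<open>insert w S\<close> lie on distinct levels, so the first
    half of \<open>compat\<close> is vacuous here and only the wall remains.\<close>
  have inn: "compat (S', lo', hi') p y"
    if nu: "(S', lo', hi') \<in> N" and p: "p \<in> insert w S" and y: "above S' (fst p) \<Longrightarrow> snd p \<le> lo' \<longleftrightarrow> y \<le> lo'"
    for S' lo' hi' p y
  proof -
    have "s = p" if "s \<in> S'" "fst p = fst s" for s
    proof -
      have "s \<in> insert w S" using that N1[OF nu] by auto
      then show ?thesis using inSw p that(2) by simp
    qed
    then show ?thesis using y unfolding compat_def by auto
  qed
  have bck: "compat (S', lo', hi') w (snd s)"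
    if nu: "(S', lo', hi') \<in> T" "(S', lo', hi') \<noteq> (S, lo, hi)" and s: "s \<in> S" and ab: "above S' (fst s)"
    for S' lo' hi' s
  proof -
    have d: "hi' \<le> lo \<or> hi \<le> lo'" using good_gaps_disjoint[OF G nu(1) tau nu(2)] .
    have S'P: "S' \<subseteq> P" and l': "lo' < hi'" using good_gap[OF G nu(1)] by auto
    have "compat (S', lo', hi') s z" using out[OF nu, of s z] s z by blast
    then have v: "snd s \<le> lo' \<longleftrightarrow> z \<le> lo'" using ab unfolding compat_def by simp
    have sf: "snd s \<le> lo' \<or> hi' \<le> snd s" using good_gap_free[OF G nu(1)] s SP by blast
    have ow: "compat (S', lo', hi') w z" using out[OF nu, of w z] z by blast
    have q: "hi' \<le> z \<Longrightarrow> hi' \<le> snd s" "z \<le> lo' \<Longrightarrow> snd s \<le> lo'" using v sf l' by auto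
    show ?thesis unfolding compat_def prod.case w fst_conv snd_conv
    proof (intro conjI ballI impI)
      fix s0 assume s0: "s0 \<in> S'" "n = fst s0"
      show "z < snd s0 \<Longrightarrow> snd s \<le> lo'" "snd s0 < z \<Longrightarrow> hi' \<le> snd s"
        using ow s0 q unfolding compat_def w by auto
    qed (use v in simp)
  qed
  show ?thesis unfolding good_def
  proof (intro conjI)
    show "\<forall>(S', lo', hi')\<in>T - {(S, lo, hi)} \<union> N. S' \<subseteq> insert w P \<and> lo' < hi' \<and>
       (\<forall>p\<in>insert w P. snd p \<le> lo' \<or> hi' \<le> snd p)"
      unfolding ball_triple
    proof (intro allI impI)
      fix S' lo' hi' assume "(S', lo', hi') \<in> T - {(S, lo, hi)} \<union> N"
      then consider (a) "(S', lo', hi') \<in> T" "(S', lo', hi') \<noteq> (S, lo, hi)" | (b) "(S', lo', hi') \<in> N" by blast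
      then show "S' \<subseteq> insert w P \<and> lo' < hi' \<and> (\<forall>p\<in>insert w P. snd p \<le> lo' \<or> hi' \<le> snd p)"
      proof cases
        case a
        have "hi' \<le> lo \<or> hi \<le> lo'" using good_gaps_disjoint[OF G a(1) tau a(2)] .
        then show ?thesis using good_gap[OF G a(1)] good_gap_free[OF G a(1)] z w by auto
      next
        case b
        show ?thesis using N1[OF b] gf SP w by fastforce
      qed
    qed
    show "\<forall>(p, q)\<in>?E. p \<in> insert w P \<and> q \<in> insert w P \<and> (q, p) \<in> ?E"
      using good_edge[OF G] SP by fast
    show "\<forall>(p, k)\<in>?K. p \<in> insert w P \<and> k \<in> snd ` insert w P"
      using good_mark[OF G] SP by fast
    show "\<forall>(S1, lo1, hi1)\<in>T - {(S, lo, hi)} \<union> N. \<forall>(S', lo', hi')\<in>T - {(S, lo, hi)} \<union> N.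
       (S1, lo1, hi1) \<noteq> (S', lo', hi') \<longrightarrow> (hi1 \<le> lo' \<or> hi' \<le> lo1) \<and>
        (\<forall>s\<in>S'. \<forall>y. lo' < y \<and> y < hi' \<longrightarrow> compat (S1, lo1, hi1) s y)"
    proof -
      have "(hi1 \<le> lo' \<or> hi' \<le> lo1) \<and> (\<forall>s\<in>S'. \<forall>y. lo' < y \<and> y < hi' \<longrightarrow> compat (S1, lo1, hi1) s y)"
        if 1: "(S1, lo1, hi1) \<in> T - {(S, lo, hi)} \<union> N"
         and 2: "(S', lo', hi') \<in> T - {(S, lo, hi)} \<union> N" and ne: "(S1, lo1, hi1) \<noteq> (S', lo', hi')"
        for S1 lo1 hi1 S' lo' hi'
      proof (cases "(S1, lo1, hi1) \<in> N")
        case n1: True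
        note m1 = N1[OF n1]
        show ?thesis
        proof (cases "(S', lo', hi') \<in> N")
          case n2: True
          note c = N3[OF n1 n2 ne]
          show ?thesis
          proof (intro conjI ballI allI impI)
            show "hi1 \<le> lo' \<or> hi' \<le> lo1" using c by blast
            fix s y assume s: "s \<in> S'" and y: "lo' < y \<and> y < hi'"
            show "compat (S1, lo1, hi1) s y"
            proof (rule inn[OF n1])
              show "s \<in> insert w S" using N1[OF n2] s by blast
              assume "above S1 (fst s)"
              then have "snd s \<le> lo1 \<longleftrightarrow> hi' \<le> lo1" using c s by blast
              then show "snd s \<le> lo1 \<longleftrightarrow> y \<le> lo1" using c y m1 by linarith
            qed
          qed
        next
          case False
          then have 2: "(S', lo', hi') \<in> T" "(S', lo', hi') \<noteq> (S, lo, hi)" using 2 by auto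
          have d: "hi' \<le> lo \<or> hi \<le> lo'" using good_gaps_disjoint[OF G 2(1) tau 2(2)] .
          show ?thesis
          proof (intro conjI ballI allI impI)
            show "hi1 \<le> lo' \<or> hi' \<le> lo1" using d m1 by auto
            fix s y assume s: "s \<in> S'" and y: "lo' < y \<and> y < hi'"
            have "compat (S, lo, hi) s y" using good_gap_gap[OF G tau 2(1) 2(2)[symmetric] s] y by blast
            then show "compat (S1, lo1, hi1) s y"
              using sub n1 good_gap[OF G 2(1)] s y d by (meson le_less_trans less_imp_le less_le_trans order_trans subsetD)
          qed
        qed
      next
        case False
        then have 1: "(S1, lo1, hi1) \<in> T" "(S1, lo1, hi1) \<noteq> (S, lo, hi)" using 1 by auto
        show ?thesis
        proof (cases "(S', lo', hi') \<in> N")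
          case n2: True
          have d: "hi1 \<le> lo \<or> hi \<le> lo1" using good_gaps_disjoint[OF G 1(1) tau 1(2)] .
          show ?thesis
          proof (intro conjI ballI allI impI)
            show "hi1 \<le> lo' \<or> hi' \<le> lo1" using d N1[OF n2] by auto
            fix s y assume s: "s \<in> S'" and y: "lo' < y \<and> y < hi'"
            show "compat (S1, lo1, hi1) s y"
              by (rule out[OF 1]) (use N1[OF n2] s y in auto)
          qed
        next
          case False
          then have 2: "(S', lo', hi') \<in> T" using 2 by auto
          show ?thesis
            using good_gap_gap[OF G 1(1) 2 ne] good_gaps_disjoint[OF G 1(1) 2 ne] by blast
        qed
      qed
      then show ?thesis unfolding ball_triple by blast
    qed
    show "\<forall>(S', lo', hi')\<in>T - {(S, lo, hi)} \<union> N. \<forall>(p, q)\<in>?E. above S' (fst q) \<longrightarrow> compat (S', lo', hi') p (snd q)"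
      unfolding ball_triple ball_pair
    proof (intro allI impI)
      fix S' lo' hi' p q
      assume 1: "(S', lo', hi') \<in> T - {(S, lo, hi)} \<union> N" and 2: "(p, q) \<in> ?E"
        and ab: "above S' (fst q)"
      have 1: "(S', lo', hi') \<in> N \<or> (S', lo', hi') \<in> T \<and> (S', lo', hi') \<noteq> (S, lo, hi)" using 1 by blast
      consider (a) "(p, q) \<in> E" | (b) "p \<in> S" "q = w" | (c) "p = w" "q \<in> S"
        using 2 by blast
      then show "compat (S', lo', hi') p (snd q)"
      proof cases
        case a
        show ?thesis
        proof (cases "(S', lo', hi') \<in> N")
          case True
          then have "above S (fst q)" using N1[OF True] ab by blast
          then have "compat (S, lo, hi) p (snd q)" using good_gap_edge[OF G tau a] by blast
          then show ?thesis using sub[OF _ True] good_edge[OF G a] gf by blast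
        next
          case False
          then show ?thesis using good_gap_edge[OF G _ a] 1 ab by blast
        qed
      next
        case b
        show ?thesis
        proof (cases "(S', lo', hi') \<in> N")
          case True
          show ?thesis by (rule inn[OF True]) (use b N2[OF True] w in auto)
        next
          case False
          then show ?thesis using out[of S' lo' hi' p z] b z 1 sw by blast
        qed
      next
        case c
        show ?thesis
        proof (cases "(S', lo', hi') \<in> N")
          case True
          show ?thesis by (rule inn[OF True]) (use c N2[OF True, of q] ab sw in auto)
        next
          case False
          then show ?thesis using bck[of S' lo' hi' q] c ab 1 by blast
        qed
      qed
    qed
    show "\<forall>g\<in>T - {(S, lo, hi)} \<union> N. \<forall>(p, k)\<in>?K. compat g p k"
      unfolding ball_pair
    proof (intro ballI allI impI)
      fix g p k
      assume 1: "g \<in> T - {(S, lo, hi)} \<union> N" and 2: "(p, k) \<in> ?K"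
      obtain S' lo' hi' where g: "g = (S', lo', hi')" by (cases g)
      have 1: "(S', lo', hi') \<in> N \<or> (S', lo', hi') \<in> T \<and> (S', lo', hi') \<noteq> (S, lo, hi)" using 1 g by blast
      consider (a) "(p, k) \<in> K" | (b) "p \<in> insert w S" "k = z"
        using 2 sw by blast
      then have "compat (S', lo', hi') p k"
      proof cases
        case a
        then obtain p' where "p \<in> P" "p' \<in> P" "k = snd p'" using good_mark[OF G a] by blast
        then show ?thesis
          using sub good_gap_mark[OF G _ a] 1 tau gf by blast
      next
        case b
        show ?thesis
        proof (cases "(S', lo', hi') \<in> N")
          case True
          show ?thesis by (rule inn[OF True]) (use b N2[OF True] in auto)
        next
          case False
          then show ?thesis using out[of S' lo' hi' p z] b z 1 by blast
        qed
      qed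
      then show "compat g p k" by (simp only: g)
    qed
    \<comment> \<open>An old edge between the levels of \<open>s\<close> and \<open>w\<close> must
      pass the whole gap on the correct side; this excludes crossings with the new edge from
      \<open>s\<close> to \<open>w\<close>.\<close>
    have half: "snd p < snd s \<Longrightarrow> snd q \<le> lo" "snd s < snd p \<Longrightarrow> hi \<le> snd q"
      if "(p, q) \<in> E" "s \<in> S" "fst p = fst s" "fst q = n" for p q s
      using good_gap_edge[OF G tau that(1)] that an unfolding compat_def by auto
    show "\<forall>(p, q)\<in>?E. \<forall>(p', q')\<in>?E. fst p = fst p' \<and> fst q = fst q' \<and> snd p < snd p' \<longrightarrow> snd q \<le> snd q'"
      unfolding ball_pair
    proof (intro allI impI, elim conjE)
      fix p q p' q'
      assume pq: "(p, q) \<in> ?E" "(p', q') \<in> ?E"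
        and e: "fst p = fst p'" "fst q = fst q'" "snd p < snd p'"
      have 1: "(p, q) \<in> E \<or> p \<in> S \<and> q = w \<or> p = w \<and> q \<in> S"
        and 2: "(p', q') \<in> E \<or> p' \<in> S \<and> q' = w \<or> p' = w \<and> q' \<in> S"
        using pq by blast+
      have wS: "fst s \<noteq> n" if "s \<in> S" for s using nS that by force
      have inS: "s = s'" if "s \<in> S" "s' \<in> S" "fst s = fst s'" for s s' using inSw that by blast
      show "snd q \<le> snd q'"
      proof (rule ccontr)
        assume neg: "\<not> snd q \<le> snd q'"
        show False
        proof (cases "(p, q) \<in> E")
          case E1: True
          then have E1': "(q, p) \<in> E" using good_edge[OF G] by blast
          show False
          proof (cases "(p', q') \<in> E")
            case True
            then show False using good_edge_edge[OF G E1 True] e neg by auto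
          next
            case False
            then consider "p' \<in> S" "q' = w" | "p' = w" "q' \<in> S" using 2 by blast
            then show False
            proof cases
              case 1 then show False using half(1)[OF E1, of p'] e neg z w by auto
            next
              case 2 then show False using half(2)[OF E1', of q'] e neg z w by auto
            qed
          qed
        next
          case F: False
          show False
          proof (cases "(p', q') \<in> E")
            case E2: True
            then have E2': "(q', p') \<in> E" using good_edge[OF G] by blast
            from F consider "p \<in> S" "q = w" | "p = w" "q \<in> S" using 1 by blast
            then show False
            proof cases
              case 1 then show False using half(2)[OF E2, of p] e neg z w by auto
            next
              case 2 then show False using half(1)[OF E2', of q] e neg z w by auto
            qed
          next
            case False
            then show False using F 1 2 e neg wS inS w by (metis fst_conv linorder_not_le order_less_irrefl)
          qed
        qed
      qed
    qed
    \<comment> \<open>Old positions stay outside the gap and the new one is strictly inside it,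
      which makes the order of the marks strict.\<close>
    have mk: "snd p < snd s \<Longrightarrow> k \<le> lo" "snd s < snd p \<Longrightarrow> hi \<le> k"
      if pk: "(p, k) \<in> K" and s: "s \<in> insert w S" "fst p = fst s" for p k s
    proof -
      have c: "compat (S, lo, hi) p k" using good_gap_mark[OF G tau pk] .
      obtain p' where p': "p \<in> P" "p' \<in> P" "k = snd p'" using good_mark[OF G pk] by blast
      have "(snd p < snd s \<longrightarrow> k \<le> lo) \<and> (snd s < snd p \<longrightarrow> hi \<le> k)"
      proof (cases "s = w")
        case True
        then have "snd p \<le> lo \<longleftrightarrow> k \<le> lo" using c an s w unfolding compat_def by auto
        then show ?thesis using gf[OF p'(1)] gf[OF p'(2)] p' z True w by auto
      next
        case False
        then show ?thesis using c s unfolding compat_def by auto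
      qed
      then show "snd p < snd s \<Longrightarrow> k \<le> lo" "snd s < snd p \<Longrightarrow> hi \<le> k" by auto
    qed
    show "\<forall>(p, k)\<in>?K. \<forall>(p', k')\<in>?K. fst p = fst p' \<and> snd p < snd p' \<longrightarrow> k < k'"
      unfolding ball_pair
    proof (intro allI impI, elim conjE)
      fix p k p' k'
      assume pk: "(p, k) \<in> ?K" "(p', k') \<in> ?K" and e: "fst p = fst p'" "snd p < snd p'"
      have 1: "(p, k) \<in> K \<or> p \<in> insert w S \<and> k = z" and 2: "(p', k') \<in> K \<or> p' \<in> insert w S \<and> k' = z"
        using pk sw by blast+
      show "k < k'"
        using 1 2 good_mark_mark[OF G, of p k p' k'] mk(1)[of p k p'] mk(2)[of p' k' p] inSw[of p p'] e z by fastforce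
    qed
  qed
qed

section \<open>Choosing the position of a new vertex\<close>

definition near :: "nat \<Rightarrow> nat \<Rightarrow> bool" where
  "near m n \<longleftrightarrow> m = n + 1 \<or> m = n + 2 \<or> n = m + 1 \<or> n = m + 2"

text \<open>The positions chosen below are those of an upward planar drawing of the bag: a vertex hung from an
  edge of span 1 goes one level above it, a vertex hung from an edge of span 2 goes between its ends.\<close>

lemma splits_empty:
  assumes "lo < z" "z \<le> l1" "l1 < h1" "h1 \<le> l2" "l2 < h2" "h2 \<le> l3" "l3 < h3" "h3 \<le> l4" "l4 < h4" "h4 \<le> hi"
  shows "splits ({}, lo, hi) (0, z) {({(0, z)}, l1, h1), ({(0, z)}, l2, h2), ({(0, z)}, l3, h3), ({}, l4, h4)}"
  using assms unfolding splits_def by (simp add: above_def) 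

text \<open>The order of the gaps is forced. Each gap at \<open>{y, w}\<close> is a wall for
  \<open>w\<close> and must have the other gaps hung from \<open>w\<close> on the same side as
  \<open>w\<close>. So the two gaps at \<open>{y, w}\<close> lie on opposite sides of
  \<open>w\<close>, and the gap at \<open>{w}\<close> lies between them.\<close>

lemma splits_single:
  assumes "lo \<le> l1" "l1 < h1" "h1 \<le> z" "z \<le> l2" "l2 < h2" "h2 \<le> l3" "l3 < h3" "h3 \<le> hi" "w = (fst y + 1, z)"
  shows "splits ({y}, lo, hi) w {({y, w}, l1, h1), ({w}, l2, h2), ({y, w}, l3, h3)}"
  using assms unfolding splits_def by (cases y) (simp add: above_def)

text \<open>A gap at \<open>{u, w}\<close> is a wall on all levels above \<open>u\<close>, so
  \<open>v\<close>, \<open>w\<close> and the gap at \<open>{v, w}\<close> must be on one side of it: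
  it goes outermost, away from \<open>v\<close>. Since \<open>w\<close> is above \<open>v\<close>,
  the gap at \<open>{v, w}\<close> is no wall for \<open>v\<close> and fits between the two.\<close>

lemma splits_short_left:
  assumes "fst v = fst u + 1" "w = (fst u + 2, z)" "hi \<le> snd v"
    and "lo \<le> l1" "l1 < h1" "h1 \<le> z" "z \<le> l2" "l2 < h2" "h2 \<le> hi"
  shows "splits ({u, v}, lo, hi) w {({u, w}, l1, h1), ({v, w}, l2, h2)}"
  using assms unfolding splits_def by (cases u; cases v) (simp add: above_def, linarith?)

lemma splits_short_right:
  assumes "fst v = fst u + 1" "w = (fst u + 2, z)" "snd v \<le> lo"
    and "lo \<le> l1" "l1 < h1" "h1 \<le> z" "z \<le> l2" "l2 < h2" "h2 \<le> hi"
  shows "splits ({u, v}, lo, hi) w {({v, w}, l1, h1), ({u, w}, l2, h2)}"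
  using assms unfolding splits_def by (cases u; cases v) (simp add: above_def, linarith?)

text \<open>Now \<open>w\<close> is below \<open>v\<close>, so the gap at \<open>{v, w}\<close> is a
  wall for \<open>v\<close> and cannot separate it from \<open>w\<close>. Both gaps therefore lie
  beyond \<open>w\<close> as seen from \<open>v\<close>.\<close>

lemma splits_long_left:
  assumes "fst v = fst u + 2" "w = (fst u + 1, z)" "hi \<le> snd v"
    and "lo \<le> l1" "l1 < h1" "h1 \<le> l2" "l2 < h2" "h2 \<le> z" "z < hi"
  shows "splits ({u, v}, lo, hi) w {({u, w}, l1, h1), ({v, w}, l2, h2)}"
  using assms unfolding splits_def by (cases u; cases v) (simp add: above_def, linarith?)

lemma splits_long_right:
  assumes "fst v = fst u + 2" "w = (fst u + 1, z)" "snd v \<le> lo"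
    and "lo < z" "z \<le> l1" "l1 < h1" "h1 \<le> l2" "l2 < h2" "h2 \<le> hi"
  shows "splits ({u, v}, lo, hi) w {({v, w}, l1, h1), ({u, w}, l2, h2)}"
  using assms unfolding splits_def by (cases u; cases v) (simp add: above_def, linarith?)

text \<open>\<open>X\<close> is the part of the open clique \<open>C\<close> in the bag being
  filled. The new clique omitting \<open>c\<close> needs a gap in this bag unless
  \<open>C - {c}\<close> is contained in \<open>X\<close>; then it lies entirely in the bag and
  opens a child bag. If \<open>X\<close> is empty, \<open>C\<close> stays open and its own gap must
  be renewed, hence \<open>L0\<close> and \<open>H0\<close>.\<close>

lemma split_exists:
  fixes C X :: "'a set" and pt :: "'a \<Rightarrow> point"
  assumes C: "card C = 3" and X: "X \<subseteq> C" "card X \<le> 2" and lh: "lo < hi"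
    and nr: "\<And>s s'. s \<in> X \<Longrightarrow> s' \<in> X \<Longrightarrow> s \<noteq> s' \<Longrightarrow> near (fst (pt s)) (fst (pt s'))"
    and free: "\<And>s. s \<in> X \<Longrightarrow> snd (pt s) \<le> lo \<or> hi \<le> snd (pt s)"
  obtains w L H L0 H0 where
    "splits (pt ` X, lo, hi) w
       ({(insert w (pt ` (X - {c})), L c, H c) |c. c \<in> C \<and> \<not> C - {c} \<subseteq> X} \<union>
        (if X = {} then {({}, L0, H0)} else {}))"
    "\<And>c c'. c \<in> C \<Longrightarrow> \<not> C - {c} \<subseteq> X \<Longrightarrow> c' \<in> C \<Longrightarrow> \<not> C - {c'} \<subseteq> X \<Longrightarrow> L c = L c' \<Longrightarrow> c = c'"
    "\<And>c. X = {} \<Longrightarrow> c \<in> C \<Longrightarrow> L c \<noteq> L0"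
    "\<And>s. s \<in> X \<Longrightarrow> near (fst w) (fst (pt s))"
    "card X = 2 \<Longrightarrow> \<exists>m. \<forall>p\<in>insert w (pt ` X). m \<le> fst p \<and> fst p \<le> m + 2"
proof -
  \<comment> \<open>Ten units leave room for every arrangement below with gaps of length
    \<open>d\<close>. Their left ends are kept distinct because they later identify the open
    cliques.\<close>
  define d where "d = (hi - lo) / 10"
  have d: "d > 0" and hi: "hi = lo + 10 * d" using lh by (auto simp: d_def field_simps)
  have fC: "finite C" using C card.infinite by fastforce
  have fX: "finite X" using X fC finite_subset by blast
  consider "card X = 0" | "card X = 1" | "card X = 2" using X(2) by linarith
  then show thesis
  proof cases
    case 1
    then have X0: "X = {}" using fX by simp
    obtain c1 c2 c3 where c: "C = {c1, c2, c3}" "c1 \<noteq> c2" "c1 \<noteq> c3" "c2 \<noteq> c3"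
      using C by (auto simp: card_3_iff)
    define L where "L = (\<lambda>c. if c = c1 then lo + d else if c = c2 then lo + 2 * d else lo + 3 * d)"
    define w where "w = (0::nat, lo + d)"
    have "{c \<in> C. \<not> C - {c} \<subseteq> X} = {c1, c2, c3}" unfolding X0 using c by auto
    then have set: "{(insert w (pt ` (X - {c})), L c, L c + d) |c. c \<in> C \<and> \<not> C - {c} \<subseteq> X} =
        (\<lambda>c. (insert w (pt ` (X - {c})), L c, L c + d)) ` {c1, c2, c3}" by blast
    show thesis
    proof (rule that[of w L "\<lambda>c. L c + d" "lo + 4 * d" "lo + 5 * d"])
      have "splits ({}, lo, hi) w {({w}, lo + d, lo + d + d), ({w}, lo + 2 * d, lo + 2 * d + d),
         ({w}, lo + 3 * d, lo + 3 * d + d), ({}, lo + 4 * d, lo + 5 * d)}"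
        unfolding w_def by (rule splits_empty) (use d hi in auto)
      then show "splits (pt ` X, lo, hi) w
       ({(insert w (pt ` (X - {c})), L c, L c + d) |c. c \<in> C \<and> \<not> C - {c} \<subseteq> X} \<union>
        (if X = {} then {({}, lo + 4 * d, lo + 5 * d)} else {}))"
        unfolding set unfolding X0 using c(2-4) by (simp add: L_def insert_commute)
    qed (use X0 d c in \<open>auto simp: L_def split: if_splits\<close>)
  next
    case 2
    then obtain y where y: "X = {y}" using card_1_singletonE by blast
    obtain c1 c2 where c: "C = {y, c1, c2}" "c1 \<noteq> c2" "c1 \<noteq> y" "c2 \<noteq> y"
    proof -
      have "y \<in> C" using X y by simp
      then show thesis using C that by (auto simp: card_3_iff)
    qed
    define L where "L = (\<lambda>c. if c = c1 then lo + d else if c = y then lo + 4 * d else lo + 6 * d)"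
    define w where "w = (fst (pt y) + 1, lo + 3 * d)"
    have "{c \<in> C. \<not> C - {c} \<subseteq> X} = {c1, y, c2}" unfolding y using c by auto
    then have set: "{(insert w (pt ` (X - {c})), L c, L c + d) |c. c \<in> C \<and> \<not> C - {c} \<subseteq> X} =
        (\<lambda>c. (insert w (pt ` (X - {c})), L c, L c + d)) ` {c1, y, c2}" by blast
    show thesis
    proof (rule that[of w L "\<lambda>c. L c + d" 0 0])
      have "splits ({pt y}, lo, hi) w {({pt y, w}, lo + d, lo + d + d), ({w}, lo + 4 * d, lo + 4 * d + d),
         ({pt y, w}, lo + 6 * d, lo + 6 * d + d)}"
        by (rule splits_single[where z = "lo + 3 * d"]) (use d hi w_def in auto)
      then show "splits (pt ` X, lo, hi) w
       ({(insert w (pt ` (X - {c})), L c, L c + d) |c. c \<in> C \<and> \<not> C - {c} \<subseteq> X} \<union>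
        (if X = {} then {({}, 0, 0)} else {}))"
        unfolding set unfolding y using c(2-4) by (simp add: L_def insert_commute)
    qed (use y d c in \<open>auto simp: L_def w_def near_def split: if_splits\<close>)
  next
    case 3
    then obtain u v where uv: "X = {u, v}" "u \<noteq> v" "fst (pt v) = fst (pt u) + 1 \<or> fst (pt v) = fst (pt u) + 2"
    proof -
      obtain u v where uv: "X = {u, v}" "u \<noteq> v" using 3 by (auto simp: card_2_iff)
      then have "near (fst (pt u)) (fst (pt v))" using nr by blast
      then consider "fst (pt v) = fst (pt u) + 1 \<or> fst (pt v) = fst (pt u) + 2"
        | "fst (pt u) = fst (pt v) + 1 \<or> fst (pt u) = fst (pt v) + 2" unfolding near_def by linarith
      then show thesis using uv that[of u v] that[of v u] by cases (simp, metis insert_commute)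
    qed
    obtain a where c: "C = {a, u, v}" "a \<noteq> u" "a \<noteq> v"
    proof -
      have "u \<in> C" "v \<in> C" using X uv by auto
      then show thesis using C that uv(2) by (auto simp: card_3_iff insert_commute)
    qed
    have set: "{(insert w (pt ` (X - {c})), L c, L c + d) |c. c \<in> C \<and> \<not> C - {c} \<subseteq> X} =
        {({pt u, w}, L v, L v + d), ({pt v, w}, L u, L u + d)}" for w L
    proof -
      have "{c \<in> C. \<not> C - {c} \<subseteq> X} = {v, u}" unfolding uv(1) c(1) using c(2,3) uv(2) by auto
      then have "{(insert w (pt ` (X - {c})), L c, L c + d) |c. c \<in> C \<and> \<not> C - {c} \<subseteq> X} =
        (\<lambda>c. (insert w (pt ` (X - {c})), L c, L c + d)) ` {v, u}" by blast
      moreover have "X - {v} = {u}" "X - {u} = {v}" using uv by auto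
      ultimately show ?thesis by (simp add: insert_commute)
    qed
    have im: "pt ` X = {pt u, pt v}" using uv by auto
    define n where "n = (if fst (pt v) = fst (pt u) + 1 then fst (pt u) + 2 else fst (pt u) + 1)"
    have "\<exists>z l1 l2. l1 \<noteq> l2 \<and> splits ({pt u, pt v}, lo, hi) (n, z)
       {({pt u, (n, z)}, l1, l1 + d), ({pt v, (n, z)}, l2, l2 + d)}"
    proof (cases "fst (pt v) = fst (pt u) + 1")
      case True
      have w: "(n, lo + 3 * d) = (fst (pt u) + 2, lo + 3 * d)" using True n_def by simp
      consider "hi \<le> snd (pt v)" | "snd (pt v) \<le> lo" using free[of v] uv by auto
      then show ?thesis
      proof cases
        case 1
        show ?thesis
          by (rule exI[of _ "lo + 3 * d"], rule exI[of _ "lo + d"], rule exI[of _ "lo + 4 * d"], rule conjI[rotated],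
              rule splits_short_left[OF True w 1]) (use d hi in auto)
      next
        case 2
        show ?thesis
          by (rule exI[of _ "lo + 3 * d"], rule exI[of _ "lo + 4 * d"], rule exI[of _ "lo + d"], rule conjI[rotated],
              subst insert_commute, rule splits_short_right[OF True w 2]) (use d hi in auto)
      qed
    next
      case False
      then have f: "fst (pt v) = fst (pt u) + 2" using uv by auto
      have w: "(n, z) = (fst (pt u) + 1, z)" for z :: real using False n_def by simp
      consider "hi \<le> snd (pt v)" | "snd (pt v) \<le> lo" using free[of v] uv by auto
      then show ?thesis
      proof cases
        case 1
        show ?thesis
          by (rule exI[of _ "lo + 6 * d"], rule exI[of _ "lo + d"], rule exI[of _ "lo + 4 * d"], rule conjI[rotated],
              rule splits_long_left[OF f w 1]) (use d hi in auto)
      next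
        case 2
        show ?thesis
          by (rule exI[of _ "lo + d"], rule exI[of _ "lo + 6 * d"], rule exI[of _ "lo + 4 * d"], rule conjI[rotated],
              subst insert_commute, rule splits_long_right[OF f w 2]) (use d hi in auto)
      qed
    qed
    then obtain z l1 l2 where z: "l1 \<noteq> l2" "splits ({pt u, pt v}, lo, hi) (n, z)
       {({pt u, (n, z)}, l1, l1 + d), ({pt v, (n, z)}, l2, l2 + d)}" by blast
    define L where "L = (\<lambda>c. if c = v then l1 else l2)"
    have nn: "near n (fst (pt u))" "near n (fst (pt v))"
      "\<forall>p\<in>insert (n, z) {pt u, pt v}. fst (pt u) \<le> fst p \<and> fst p \<le> fst (pt u) + 2"
      using uv(3) unfolding n_def near_def by auto
    show thesis
    proof (rule that[of "(n, z)" L "\<lambda>c. L c + d" 0 0])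
      show "splits (pt ` X, lo, hi) (n, z)
       ({(insert (n, z) (pt ` (X - {c})), L c, L c + d) |c. c \<in> C \<and> \<not> C - {c} \<subseteq> X} \<union>
        (if X = {} then {({}, 0, 0)} else {}))"
        unfolding set im using z uv by (simp add: L_def)
      show "\<exists>m. \<forall>p\<in>insert (n, z) (pt ` X). m \<le> fst p \<and> fst p \<le> m + 2" using nn im by auto
    qed (use uv nn c z in \<open>auto simp: L_def split: if_splits\<close>)
  qed
qed

subsection \<open>Decomposition into bags\<close>

type_synonym bag = "(nat \<times> real) list"

text \<open>A bag is named by the path leading to it, innermost step first: the child bag of \<open>\<beta>\<close> inside a triangle
  of lowest level \<open>m\<close> and position \<open>k\<close> is \<open>(m, k) # \<beta>\<close>. \<open>Q\<close> contains the 3-cliques \<open>C\<close> that may still receive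
  a vertex; this vertex goes to the bag \<open>t C\<close>, and \<open>sh C\<close> is the part of \<open>C\<close> in that bag. Cliques with \<open>sh C = {}\<close>
  lie in the parent bag and stay in \<open>Q\<close> forever, which accommodates the base triangle with its two sides.\<close>

locale bagging =
  fixes V :: "'a set" and E :: "'a set set"
    and b :: "'a \<Rightarrow> bag" and pt :: "'a \<Rightarrow> point"
    and t :: "'a set \<Rightarrow> bag" and lo hi :: "'a set \<Rightarrow> real" and Q :: "'a set set"
    and P :: "bag \<Rightarrow> point set" and T :: "bag \<Rightarrow> gap set"
    and Ed :: "bag \<Rightarrow> (point \<times> point) set" and K :: "bag \<Rightarrow> (point \<times> real) set" and U :: "bag set"
    and sh :: "'a set \<Rightarrow> 'a set"
  defines "sh C \<equiv> {c \<in> C. b c = t C}"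
  assumes good: "good (P \<beta>) (T \<beta>) (Ed \<beta>) (K \<beta>)"
    and pt_in: "v \<in> V \<Longrightarrow> pt v \<in> P (b v) \<and> b v \<in> U"
    and pt_inj: "v \<in> V \<Longrightarrow> v' \<in> V \<Longrightarrow> b v = b v' \<Longrightarrow> pt v = pt v' \<Longrightarrow> v = v'"
    and open_sub: "C \<in> Q \<Longrightarrow> C \<subseteq> V \<and> card C = 3 \<and> t C \<in> U"
    and open_gap: "C \<in> Q \<Longrightarrow> (pt ` sh C, lo C, hi C) \<in> T (t C)"
    and open_card: "C \<in> Q \<Longrightarrow> card (sh C) \<le> 2"
    and open_near: "C \<in> Q \<Longrightarrow> s \<in> sh C \<Longrightarrow> s' \<in> sh C \<Longrightarrow> s \<noteq> s' \<Longrightarrow> near (fst (pt s)) (fst (pt s'))"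
    and open_inj: "C \<in> Q \<Longrightarrow> C' \<in> Q \<Longrightarrow> t C = t C' \<Longrightarrow> lo C = lo C' \<Longrightarrow> C = C'"
    and open_parent: "C \<in> Q \<Longrightarrow> \<exists>D\<in>Q. t D = t C \<and> sh D = {} \<and> C - sh C \<subseteq> D"
    and root_level: "D \<in> Q \<Longrightarrow> sh D = {} \<Longrightarrow> \<exists>m k \<beta>. t D = (m, k) # \<beta> \<and>
          (\<forall>p\<in>D. b p = \<beta> \<and> m \<le> fst (pt p) \<and> fst (pt p) \<le> m + 2 \<and> (pt p, k) \<in> K \<beta>)"
    and edge_cases: "{p, q} \<in> E \<Longrightarrow> p \<in> V \<and> q \<in> V \<and>
          (b p = b q \<and> near (fst (pt p)) (fst (pt q)) \<and> (pt p, pt q) \<in> Ed (b p) \<or>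
           (\<exists>D\<in>Q. sh D = {} \<and> (t D = b q \<and> p \<in> D \<or> t D = b p \<and> q \<in> D)))"
    and closed_nbrs: "C \<subseteq> V \<Longrightarrow> card C = 3 \<Longrightarrow> clique_edges C \<subseteq> E \<Longrightarrow> C \<notin> Q \<Longrightarrow>
          \<exists>y z. y \<noteq> z \<and> (\<forall>c\<in>C. {y, c} \<in> E \<and> {z, c} \<in> E)"
    and open_nbr: "C \<in> Q \<Longrightarrow> sh C \<noteq> {} \<Longrightarrow> \<exists>y. \<forall>c\<in>C. {y, c} \<in> E"
    and unused: "\<beta> \<notin> U \<Longrightarrow> P \<beta> = {} \<and> T \<beta> = {} \<and> Ed \<beta> = {} \<and> K \<beta> = {}"
    and used: "(m, k) # \<beta> \<in> U \<Longrightarrow> k \<in> snd ` P \<beta>"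

section \<open>Growing the decomposition by one vertex\<close>

lemma good_init: "good {} {({}, 0, 1)} {} {}"
  unfolding good_def by simp

text \<open>Only the bag \<open>t C\<close> changes, and at most one child bag appears. The count
  that later meets planarity is this: a new clique \<open>insert w (C - {c})\<close> has the common
  neighbour \<open>c\<close> from the start (\<open>open_nbr\<close>), so when it is filled and
  leaves \<open>Q\<close> it has two (\<open>closed_nbrs\<close>).\<close>

lemma (in bagging) extend:
  assumes CQ: "C \<in> Q" and wV: "w \<notin> V" and clq: "clique_edges C \<subseteq> E"
  shows "\<exists>b' pt' t' lo' hi' Q' P' T' Ed' K' U'.
    bagging (insert w V) (E \<union> {{w, c} | c. c \<in> C}) b' pt' t' lo' hi' Q' P' T' Ed' K' U'"
proof -
  define X \<beta> where "X = sh C" and "\<beta> = t C"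
  have C: "C \<subseteq> V" "card C = 3" "\<beta> \<in> U" using open_sub[OF CQ] \<beta>_def by auto
  have fC: "finite C" using C(2) card.infinite by fastforce
  have XC: "X \<subseteq> C" and Xb: "\<And>s. s \<in> X \<Longrightarrow> b s = \<beta>" unfolding X_def \<beta>_def sh_def by auto
  have tau: "(pt ` X, lo C, hi C) \<in> T \<beta>" using open_gap[OF CQ] X_def \<beta>_def by simp
  note G = good[of \<beta>]
  have lh: "lo C < hi C" using good_gap[OF G tau] by simp
  have cX: "card X \<le> 2" using open_card[OF CQ] X_def by simp
  obtain wp L H L0 H0 where
    sp: "splits (pt ` X, lo C, hi C) wp
       ({(insert wp (pt ` (X - {c})), L c, H c) |c. c \<in> C \<and> \<not> C - {c} \<subseteq> X} \<union>
        (if X = {} then {({}, L0, H0)} else {}))"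
    and Linj: "\<And>c c'. c \<in> C \<Longrightarrow> \<not> C - {c} \<subseteq> X \<Longrightarrow> c' \<in> C \<Longrightarrow> \<not> C - {c'} \<subseteq> X \<Longrightarrow> L c = L c' \<Longrightarrow> c = c'"
    and L0: "\<And>c. X = {} \<Longrightarrow> c \<in> C \<Longrightarrow> L c \<noteq> L0"
    and wn: "\<And>s. s \<in> X \<Longrightarrow> near (fst wp) (fst (pt s))"
    and lev: "card X = 2 \<Longrightarrow> \<exists>m. \<forall>p\<in>insert wp (pt ` X). m \<le> fst p \<and> fst p \<le> m + 2"
  proof (rule split_exists[of C X "lo C" "hi C" pt])
    show "snd (pt s) \<le> lo C \<or> hi C \<le> snd (pt s)" if "s \<in> X" for s
    proof -
      have "pt s \<in> P \<beta>" using pt_in[of s] that XC C(1) Xb by auto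
      then show ?thesis by (rule good_gap_free[OF G tau])
    qed
  qed (use C XC cX lh open_near[OF CQ] X_def in auto)
  define N where "N = {(insert wp (pt ` (X - {c})), L c, H c) |c. c \<in> C \<and> \<not> C - {c} \<subseteq> X} \<union>
        (if X = {} then {({}, L0, H0)} else {})"
  have sp: "splits (pt ` X, lo C, hi C) wp N" using sp N_def by simp
  have zin: "lo C < snd wp" "snd wp < hi C" using sp unfolding splits_def by auto
  have Nin: "lo C \<le> l' \<and> l' < hi C" if "(S', l', h') \<in> N" for S' l' h'
  proof -
    have "lo C \<le> l' \<and> l' < h' \<and> h' \<le> hi C" using sp that unfolding splits_def prod.case ball_triple by blast
    then show ?thesis by auto
  qed
  obtain m where m: "card X = 2 \<Longrightarrow> \<forall>p\<in>insert wp (pt ` X). m \<le> fst p \<and> fst p \<le> m + 2" using lev by blast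
  \<comment> \<open>The name of the child bag opened when \<open>card X = 2\<close>; otherwise
    \<open>m\<close> is arbitrary and \<open>\<gamma>\<close> never becomes used. By
    \<open>used\<close>, a name in \<open>U\<close> carries an abscissa present in its parent, and
    that of \<open>wp\<close> is new, so \<open>\<gamma>\<close> is a fresh name.\<close>
  define \<gamma> where "\<gamma> = (m, snd wp) # \<beta>"
  have gb: "\<gamma> \<noteq> \<beta>" unfolding \<gamma>_def by simp
  have zfresh: "snd wp \<notin> snd ` P \<beta>"
    using good_gap_free[OF G tau] zin by fastforce
  have gU: "\<gamma> \<notin> U" using used[of m "snd wp" \<beta>] zfresh unfolding \<gamma>_def by blast
  have wC: "w \<notin> C" using C(1) wV by auto
  have wQ: "w \<notin> D" if "D \<in> Q" for D using open_sub[OF that] wV by auto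
  have cX2: "card X = 2 \<and> X = C - {c}" if "c \<in> C" "C - {c} \<subseteq> X" for c
  proof -
    have "card (C - {c}) = 2" using that(1) C(2) fC by simp
    then show ?thesis using card_seteq[OF finite_subset[OF XC fC] that(2)] cX by auto
  qed
  define b' where "b' = b(w := \<beta>)"
  define pt' where "pt' = pt(w := wp)"
  \<comment> \<open>The open cliques through \<open>w\<close> are the new ones. If the rest lies in
    \<open>X\<close>, the whole triangle lies in \<open>\<beta>\<close> and gets the child bag with
    the initial gap from 0 to 1. Otherwise \<open>cc\<close> recovers the omitted vertex of
    \<open>C\<close>, which indexes the gap.\<close>
  define t' where "t' = (\<lambda>D. if w \<in> D then (if D - {w} \<subseteq> X then \<gamma> else \<beta>) else t D)"
  define cc where "cc = (\<lambda>D. THE c. c \<in> C \<and> c \<notin> D)"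
  define lo' where "lo' = (\<lambda>D. if w \<in> D then (if D - {w} \<subseteq> X then 0 else L (cc D)) else if D = C then L0 else lo D)"
  define hi' where "hi' = (\<lambda>D. if w \<in> D then (if D - {w} \<subseteq> X then 1 else H (cc D)) else if D = C then H0 else hi D)"
  define Q' where "Q' = {D \<in> Q. D \<noteq> C \<or> X = {}} \<union> {insert w (C - {c}) |c. c \<in> C}"
  define P' where "P' = P(\<beta> := insert wp (P \<beta>))"
  define T' where "T' = T(\<beta> := T \<beta> - {(pt ` X, lo C, hi C)} \<union> N, \<gamma> := (if card X = 2 then {({}, 0, 1)} else T \<gamma>))"
  define Ed' where "Ed' = Ed(\<beta> := Ed \<beta> \<union> {(s, wp) |s. s \<in> pt ` X} \<union> {(wp, s) |s. s \<in> pt ` X})"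
  define K' where "K' = K(\<beta> := K \<beta> \<union> {(p, snd wp) |p. p \<in> insert wp (pt ` X)})"
  define U' where "U' = (if card X = 2 then insert \<gamma> U else U)"
  define sh' where "sh' = (\<lambda>D. {c \<in> D. b' c = t' D})"
  let ?E = "E \<union> {{w, c} | c. c \<in> C}"
  define nw where "nw = (\<lambda>c. insert w (C - {c}))"
  have agree: "b' v = b v" "pt' v = pt v" if "v \<in> V" for v using that wV by (auto simp: b'_def pt'_def)
  have bw: "b' w = \<beta>" "pt' w = wp" by (auto simp: b'_def pt'_def)
  have Q'E: "(D \<in> Q \<and> (D \<noteq> C \<or> X = {}) \<Longrightarrow> R) \<Longrightarrow>
      (\<And>c. c \<in> C \<Longrightarrow> D = nw c \<Longrightarrow> C - {c} \<subseteq> X \<Longrightarrow> R) \<Longrightarrow>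
      (\<And>c. c \<in> C \<Longrightarrow> D = nw c \<Longrightarrow> \<not> C - {c} \<subseteq> X \<Longrightarrow> R) \<Longrightarrow> R" if "D \<in> Q'" for D R
    using that unfolding Q'_def nw_def by blast
  have imp': "pt' ` D = pt ` D" if "D \<subseteq> V" for D using that agree by (force simp: image_def)
  have old_sh: "sh' D = sh D" "t' D = t D" if "D \<in> Q" for D
  proof -
    show tt: "t' D = t D" using wQ[OF that] by (simp add: t'_def)
    show "sh' D = sh D" unfolding sh'_def sh_def tt using agree open_sub[OF that] by auto
  qed
  have nwD: "nw c - {w} = C - {c}" "cc (nw c) = c" "w \<in> nw c" if "c \<in> C" for c
  proof -
    show "nw c - {w} = C - {c}" "w \<in> nw c" using wC by (auto simp: nw_def)
    have "(THE x. x \<in> C \<and> x \<notin> nw c) = c" using that wC by (intro the_equality) (auto simp: nw_def)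
    then show "cc (nw c) = c" by (simp add: cc_def)
  qed
  have new3: "t' (nw c) = \<gamma>" "sh' (nw c) = {}" "lo' (nw c) = 0" "hi' (nw c) = 1" "nw c = insert w X"
    if "c \<in> C" "C - {c} \<subseteq> X" for c
  proof -
    show tt: "t' (nw c) = \<gamma>" using nwD[OF that(1)] that by (simp add: t'_def)
    show "lo' (nw c) = 0" "hi' (nw c) = 1" using nwD[OF that(1)] that by (auto simp: lo'_def hi'_def)
    show e: "nw c = insert w X" using cX2[OF that] by (simp add: nw_def)
    have "b' p = \<beta>" if "p \<in> insert w X" for p using that bw agree Xb XC C(1) by auto
    then show "sh' (nw c) = {}" unfolding sh'_def tt unfolding e using gb by auto
  qed
  have newn: "t' (nw c) = \<beta>" "sh' (nw c) = insert w (X - {c})" "lo' (nw c) = L c" "hi' (nw c) = H c"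
    if "c \<in> C" "\<not> C - {c} \<subseteq> X" for c
  proof -
    show tt: "t' (nw c) = \<beta>" using nwD[OF that(1)] that by (simp add: t'_def)
    show "lo' (nw c) = L c" "hi' (nw c) = H c" using nwD[OF that(1)] that by (auto simp: lo'_def hi'_def)
    have "b' p = \<beta> \<longleftrightarrow> p \<in> X" if "p \<in> C" for p
      using that agree C(1) unfolding X_def \<beta>_def sh_def by auto
    then show "sh' (nw c) = insert w (X - {c})" unfolding sh'_def tt unfolding nw_def using bw XC by auto
  qed
  have cXc: "card (X - {c}) \<le> 1" if "c \<in> C" "\<not> C - {c} \<subseteq> X" for c
  proof (cases "c \<in> X")
    case True then show ?thesis using cX finite_subset[OF XC fC] by simp
  next
    case False
    have fX: "finite X" using XC fC finite_subset by blast
    have "X \<subset> C - {c}" using False XC that by auto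
    then have "card X < card (C - {c})" using fC by (intro psubset_card_mono) auto
    then have "card X < 2" using that(1) C(2) fC by simp
    then show ?thesis using False by simp
  qed
  have mono_sh: "\<exists>D'\<in>Q'. t' D' = t D \<and> sh' D' = {} \<and> D \<subseteq> D'" if "D \<in> Q" "sh D = {}" for D
    using that old_sh X_def unfolding Q'_def by blast
  \<comment> \<open>Prepares \<open>open_inj\<close>: the new left ends lie in the gap just filled,
    those of the other open cliques of \<open>\<beta>\<close> do not.\<close>
  have notin_gap: "\<not> (lo C \<le> lo D \<and> lo D < hi C)" if "D \<in> Q" "D \<noteq> C" "t D = \<beta>" for D
  proof -
    have D: "(pt ` sh D, lo D, hi D) \<in> T \<beta>" using open_gap[OF that(1)] that(3) by simp
    have "lo D \<noteq> lo C" using open_inj[OF that(1) CQ] that \<beta>_def by auto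
    then have "hi D \<le> lo C \<or> hi C \<le> lo D" using good_gaps_disjoint[OF G D tau] by auto
    then show ?thesis using good_gap[OF G D] by auto
  qed
  have lo_range: "lo C \<le> lo' D \<and> lo' D < hi C" if "D \<in> Q'" "t' D = \<beta>" "D \<notin> Q \<or> D = C" for D
    using that(1)
  proof (rule Q'E)
    assume "D \<in> Q \<and> (D \<noteq> C \<or> X = {})"
    then have "D = C" "X = {}" using that by auto
    then have "lo' D = L0" "({}, L0, H0) \<in> N" using wC by (auto simp: lo'_def N_def)
    then show ?thesis using Nin by auto
  next
    fix c assume "c \<in> C" "D = nw c" "C - {c} \<subseteq> X"
    then show ?thesis using new3[of c] gb that by auto
  next
    fix c assume c: "c \<in> C" "D = nw c" "\<not> C - {c} \<subseteq> X"
    then have "(insert wp (pt ` (X - {c})), L c, H c) \<in> N" by (auto simp: N_def)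
    then show ?thesis using newn[of c] c Nin by auto
  qed
  have "bagging (insert w V) ?E b' pt' t' lo' hi' Q' P' T' Ed' K' U'"
  proof (unfold_locales, unfold sh'_def[symmetric, THEN fun_cong])
    fix \<delta>
    consider "\<delta> = \<beta>" | "\<delta> = \<gamma>" "card X = 2" | "\<delta> \<noteq> \<beta>" "\<not> (\<delta> = \<gamma> \<and> card X = 2)" by blast
    then show "Submission.good (P' \<delta>) (T' \<delta>) (Ed' \<delta>) (K' \<delta>)"
    proof cases
      case 1
      then show ?thesis using good_split[OF G tau sp] gb unfolding P'_def T'_def Ed'_def K'_def by simp
    next
      case 2
      then show ?thesis using good_init unused[OF gU] gb unfolding P'_def T'_def Ed'_def K'_def by simp
    next
      case 3
      then have "P' \<delta> = P \<delta>" "T' \<delta> = T \<delta>" "Ed' \<delta> = Ed \<delta>" "K' \<delta> = K \<delta>"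
        unfolding P'_def T'_def Ed'_def K'_def by auto
      then show ?thesis using good[of \<delta>] by simp
    qed
  next
    fix v assume "v \<in> insert w V"
    then show "pt' v \<in> P' (b' v) \<and> b' v \<in> U'"
      using pt_in[of v] agree[of v] bw C(3) by (cases "v = w") (auto simp: P'_def U'_def)
  next
    fix v v' assume v: "v \<in> insert w V" "v' \<in> insert w V" and e: "b' v = b' v'" "pt' v = pt' v'"
    have F: False if "v \<in> V" "b v = \<beta>" "pt v = wp" for v
      using pt_in[OF that(1)] that zfresh by auto
    show "v = v'"
    proof (cases "v = w")
      case True
      then show ?thesis using v e F[of v'] agree[of v'] bw by auto
    next
      case False
      then show ?thesis using v e F[of v] agree[of v] agree[of v'] bw pt_inj by (cases "v' = w") auto
    qed
  next
    fix D assume "D \<in> Q'"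
    then show "D \<subseteq> insert w V \<and> card D = 3 \<and> t' D \<in> U'"
    proof (rule Q'E)
      assume "D \<in> Q \<and> (D \<noteq> C \<or> X = {})"
      then show ?thesis using open_sub[of D] old_sh[of D] by (auto simp: U'_def)
    next
      fix c assume c: "c \<in> C" "D = nw c" "C - {c} \<subseteq> X"
      have "card (nw c) = 3" using wC fC C(2) c(1) by (simp add: nw_def)
      moreover have "nw c \<subseteq> insert w V" using C(1) by (auto simp: nw_def)
      ultimately show ?thesis using c(2) new3(1)[OF c(1,3)] conjunct1[OF cX2[OF c(1,3)]] by (simp add: U'_def)
    next
      fix c assume c: "c \<in> C" "D = nw c" "\<not> C - {c} \<subseteq> X"
      have "card (nw c) = 3" using wC fC C(2) c(1) by (simp add: nw_def)
      moreover have "nw c \<subseteq> insert w V" using C(1) by (auto simp: nw_def)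
      ultimately show ?thesis using c(2) newn(1)[OF c(1,3)] C(3) by (simp add: U'_def)
    qed
  next
    fix D assume "D \<in> Q'"
    then show "(pt' ` sh' D, lo' D, hi' D) \<in> T' (t' D)"
    proof (rule Q'E)
      assume D: "D \<in> Q \<and> (D \<noteq> C \<or> X = {})"
      have DV: "sh D \<subseteq> V" using open_sub[of D] D unfolding sh_def by auto
      have e: "pt' ` sh' D = pt ` sh D" "t' D = t D" using imp'[OF DV] old_sh D by auto
      show ?thesis
      proof (cases "D = C")
        case True
        then have "X = {}" using D by simp
        then have "sh' D = {}" "lo' D = L0" "hi' D = H0" "t' D = \<beta>"
          using True old_sh D wC X_def \<beta>_def by (auto simp: lo'_def hi'_def)
        then show ?thesis using \<open>X = {}\<close> gb by (auto simp: T'_def N_def)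
      next
        case False
        have l: "lo' D = lo D" "hi' D = hi D" using wQ[of D] D False by (auto simp: lo'_def hi'_def)
        have "t D \<noteq> \<gamma>" using open_sub[of D] D gU by auto
        moreover have "lo D \<noteq> lo C" if "t D = \<beta>" using open_inj[of D C] CQ that D False \<beta>_def by auto
        ultimately show ?thesis unfolding e l using open_gap[of D] D by (auto simp: T'_def)
      qed
    next
      fix c assume c: "c \<in> C" "D = nw c" "C - {c} \<subseteq> X"
      show ?thesis using c(2) new3(1-4)[OF c(1,3)] conjunct1[OF cX2[OF c(1,3)]] by (simp add: T'_def)
    next
      fix c assume c: "c \<in> C" "D = nw c" "\<not> C - {c} \<subseteq> X"
      have "pt' ` insert w (X - {c}) = insert wp (pt ` (X - {c}))"
        using imp'[of "X - {c}"] XC C(1) bw by auto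
      then have "(pt' ` sh' D, lo' D, hi' D) \<in> N" using c newn[of c] by (auto simp: N_def)
      then show ?thesis using c newn[of c] gb by (simp add: T'_def)
    qed
  next
    fix D assume "D \<in> Q'"
    then show "card (sh' D) \<le> 2"
    proof (rule Q'E)
      assume D: "D \<in> Q \<and> (D \<noteq> C \<or> X = {})"
      then show ?thesis using open_card old_sh by auto
    next
      fix c assume c: "c \<in> C" "D = nw c" "C - {c} \<subseteq> X"
      then show ?thesis using new3[of c] by simp
    next
      fix c assume c: "c \<in> C" "D = nw c" "\<not> C - {c} \<subseteq> X"
      then show ?thesis using newn[of c] cXc[of c] wC XC finite_subset[OF XC fC] by (simp add: card_insert_if)
    qed
  next
    fix D s s' assume D: "D \<in> Q'" and s: "s \<in> sh' D" "s' \<in> sh' D" "s \<noteq> s'"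
    show "near (fst (pt' s)) (fst (pt' s'))" using D
    proof (rule Q'E)
      assume D: "D \<in> Q \<and> (D \<noteq> C \<or> X = {})"
      then have "s \<in> V" "s' \<in> V" using s open_sub[of D] unfolding sh'_def by auto
      then show ?thesis using open_near[of D s s'] old_sh[of D] D s agree by auto
    next
      fix c assume c: "c \<in> C" "D = nw c" "C - {c} \<subseteq> X"
      then show ?thesis using new3[of c] s by simp
    next
      fix c assume c: "c \<in> C" "D = nw c" "\<not> C - {c} \<subseteq> X"
      then have ss: "s \<in> insert w (X - {c})" "s' \<in> insert w (X - {c})" using s newn[of c] by auto
      have "s = w \<or> s' = w"
      proof (rule ccontr)
        assume "\<not> (s = w \<or> s' = w)"
        then have "s \<in> X - {c}" "s' \<in> X - {c}" using ss by auto
        then have "card {s, s'} \<le> card (X - {c})" using finite_subset[OF XC fC] by (intro card_mono) auto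
        then show False using cXc[of c] c s(3) by simp
      qed
      moreover have "near (fst wp) (fst (pt' s))" "near (fst (pt' s)) (fst wp)" if "s \<in> X" for s
        using wn[OF that] agree[of s] that XC C(1) by (auto simp: near_def)
      ultimately show ?thesis using ss s(3) bw by auto
    qed
  next
    fix D D' assume D: "D \<in> Q'" "D' \<in> Q'" and e: "t' D = t' D'" "lo' D = lo' D'"
    have old: "lo' D = lo D" "t' D = t D" if "D \<in> Q" "D \<noteq> C" for D
      using that wQ[of D] old_sh[of D] by (auto simp: lo'_def)
    have fresh: "\<exists>c. c \<in> C \<and> D = nw c" if "D \<in> Q'" "D \<notin> Q" for D
      using that unfolding Q'_def nw_def by blast
    have mix: False if "D \<in> Q" "D \<noteq> C" "D' \<in> Q'" "D' \<notin> Q \<or> D' = C" "t' D = t' D'" "lo' D = lo' D'" for D D'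
    proof -
      have "t' D' \<in> {\<beta>, \<gamma>}" using that(3)
      proof (rule Q'E)
        assume "D' \<in> Q \<and> (D' \<noteq> C \<or> X = {})"
        then have "D' = C" using that(4) by auto
        then show ?thesis using old_sh(2)[OF CQ] \<beta>_def by simp
      qed (use new3(1) newn(1) in simp_all)
      moreover have "t D \<noteq> \<gamma>" using open_sub[OF that(1)] gU by auto
      ultimately have "t D = \<beta>" "t' D' = \<beta>" using old[OF that(1,2)] that(5) by auto
      then show False using notin_gap[OF that(1,2)] lo_range[OF that(3) _ that(4)] old[OF that(1,2)] that(6) by simp
    qed
    show "D = D'"
    proof (cases "D \<in> Q \<and> D \<noteq> C")
      case True
      then have "D' \<in> Q \<and> D' \<noteq> C" using mix[of D D'] D e by auto
      then show ?thesis using True old[of D] old[of D'] e open_inj[of D D'] by auto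
    next
      case False
      then have n': "\<not> (D' \<in> Q \<and> D' \<noteq> C)" using mix[of D' D] D e by auto
      have nn: "D = D'" if "c \<in> C" "D = nw c" "c' \<in> C" "D' = nw c'" for c c'
      proof (cases "C - {c} \<subseteq> X"; cases "C - {c'} \<subseteq> X")
        show "C - {c} \<subseteq> X \<Longrightarrow> C - {c'} \<subseteq> X \<Longrightarrow> D = D'" using new3 that by metis
        show "C - {c} \<subseteq> X \<Longrightarrow> \<not> C - {c'} \<subseteq> X \<Longrightarrow> D = D'" using new3(1) newn(1) that e gb by metis
        show "\<not> C - {c} \<subseteq> X \<Longrightarrow> C - {c'} \<subseteq> X \<Longrightarrow> D = D'" using new3(1) newn(1) that e gb by metis
        show "\<not> C - {c} \<subseteq> X \<Longrightarrow> \<not> C - {c'} \<subseteq> X \<Longrightarrow> D = D'" using newn(3) that e Linj by metis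
      qed
      have CC: "X = {}" "lo' C = L0" if "C \<in> Q'"
        using that wC unfolding Q'_def lo'_def by auto
      have Cn: False if "C \<in> Q'" "c \<in> C" "lo' (nw c) = L0" for c
      proof -
        have "\<not> C - {c} \<subseteq> X" using cX2[of c] that CC by auto
        then show False using newn(3)[of c] that CC L0[of c] by auto
      qed
      have "D = C \<or> (\<exists>c. c \<in> C \<and> D = nw c)" "D' = C \<or> (\<exists>c. c \<in> C \<and> D' = nw c)"
        using False n' fresh D by auto
      then show ?thesis using nn Cn CC D e by metis
    qed
  next
    fix D assume "D \<in> Q'"
    then show "\<exists>D'\<in>Q'. t' D' = t' D \<and> sh' D' = {} \<and> D - sh' D \<subseteq> D'"
    proof (rule Q'E)
      assume D: "D \<in> Q \<and> (D \<noteq> C \<or> X = {})"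
      then obtain D' where "D' \<in> Q" "t D' = t D" "sh D' = {}" "D - sh D \<subseteq> D'" using open_parent by blast
      then show ?thesis using mono_sh[of D'] old_sh[of D] D by (metis subset_trans)
    next
      fix c assume c: "c \<in> C" "D = nw c" "C - {c} \<subseteq> X"
      then show ?thesis using new3[of c] \<open>D \<in> Q'\<close> by blast
    next
      fix c assume c: "c \<in> C" "D = nw c" "\<not> C - {c} \<subseteq> X"
      obtain D' where D': "D' \<in> Q" "t D' = \<beta>" "sh D' = {}" "C - X \<subseteq> D'"
        using open_parent[OF CQ] X_def \<beta>_def by blast
      have "D - sh' D \<subseteq> C - X" using c newn[of c] by (auto simp: nw_def)
      then show ?thesis using mono_sh[OF D'(1,3)] newn(1)[OF c(1,3)] c(2) D' by (metis subset_trans)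
    qed
  next
    fix D assume D: "D \<in> Q'" and s: "sh' D = {}"
    show "\<exists>m k \<beta>. t' D = (m, k) # \<beta> \<and>
          (\<forall>p\<in>D. b' p = \<beta> \<and> m \<le> fst (pt' p) \<and> fst (pt' p) \<le> m + 2 \<and> (pt' p, k) \<in> K' \<beta>)"
      using D
    proof (rule Q'E)
      assume D: "D \<in> Q \<and> (D \<noteq> C \<or> X = {})"
      then obtain m k \<delta> where "t D = (m, k) # \<delta>"
        and *: "\<And>p. p \<in> D \<Longrightarrow> b p = \<delta> \<and> m \<le> fst (pt p) \<and> fst (pt p) \<le> m + 2 \<and> (pt p, k) \<in> K \<delta>"
        using root_level[of D] s old_sh[of D] by blast
      moreover have "b' p = b p" "pt' p = pt p" if "p \<in> D" for p using that agree open_sub[of D] D by auto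
      moreover have "K \<delta> \<subseteq> K' \<delta>" by (auto simp: K'_def)
      ultimately show ?thesis using old_sh[of D] D by (intro exI[of _ m] exI[of _ k] exI[of _ \<delta>]) auto
    next
      fix c assume c: "c \<in> C" "D = nw c" "C - {c} \<subseteq> X"
      have D: "D = insert w X" "t' D = \<gamma>" using new3[of c] c by auto
      have "b' p = \<beta> \<and> pt' p \<in> insert wp (pt ` X)" if "p \<in> D" for p
        using that D bw agree[of p] XC C(1) Xb by auto
      then have "b' p = \<beta> \<and> m \<le> fst (pt' p) \<and> fst (pt' p) \<le> m + 2 \<and> (pt' p, snd wp) \<in> K' \<beta>" if "p \<in> D" for p
        using m[OF conjunct1[OF cX2[OF c(1,3)]]] that unfolding K'_def fun_upd_same by blast
      then show ?thesis using D(2) unfolding \<gamma>_def by blast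
    next
      fix c assume c: "c \<in> C" "D = nw c" "\<not> C - {c} \<subseteq> X"
      then show ?thesis using newn[of c] s by auto
    qed
  next
    fix p q assume "{p, q} \<in> ?E"
    then consider "{p, q} \<in> E" | c where "c \<in> C" "{p, q} = {w, c}" by blast
    then show "p \<in> insert w V \<and> q \<in> insert w V \<and>
          (b' p = b' q \<and> near (fst (pt' p)) (fst (pt' q)) \<and> (pt' p, pt' q) \<in> Ed' (b' p) \<or>
           (\<exists>D\<in>Q'. sh' D = {} \<and> (t' D = b' q \<and> p \<in> D \<or> t' D = b' p \<and> q \<in> D)))"
    proof cases
      case 1
      have "Ed (b p) \<subseteq> Ed' (b p)" by (auto simp: Ed'_def)
      moreover have pq: "p \<in> V" "q \<in> V" using edge_cases[OF 1] by auto
      moreover have "\<exists>D\<in>Q'. sh' D = {} \<and> (t' D = b q \<and> p \<in> D \<or> t' D = b p \<and> q \<in> D)"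
        if "D \<in> Q" "sh D = {}" "t D = b q \<and> p \<in> D \<or> t D = b p \<and> q \<in> D" for D
        using mono_sh[OF that(1,2)] that(3) by (metis subsetD)
      ultimately show ?thesis using edge_cases[OF 1] agree[of p] agree[of q] by auto
    next
      case 2
      have c: "b' c = b c" "pt' c = pt c" "c \<in> V" using agree C(1) 2 by auto
      have pq: "p = w \<and> q = c \<or> p = c \<and> q = w" using 2(2) by (auto simp: doubleton_eq_iff)
      show ?thesis
      proof (cases "c \<in> X")
        case True
        have "(wp, pt c) \<in> Ed' \<beta>" "(pt c, wp) \<in> Ed' \<beta>"
          unfolding Ed'_def fun_upd_same using True by blast+
        moreover have "b c = \<beta>" "near (fst wp) (fst (pt c))" "near (fst (pt c)) (fst wp)"
          using Xb[OF True] wn[OF True] by (auto simp: near_def)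
        ultimately show ?thesis using pq c bw by auto
      next
        case False
        obtain D' where D': "D' \<in> Q" "t D' = \<beta>" "sh D' = {}" "C - X \<subseteq> D'"
          using open_parent[OF CQ] X_def \<beta>_def by blast
        then obtain D where "D \<in> Q'" "t' D = \<beta>" "sh' D = {}" "c \<in> D" using mono_sh[OF D'(1,3)] 2 False by auto
        then show ?thesis using pq c bw by auto
      qed
    qed
  next
    fix D assume D: "D \<subseteq> insert w V" "card D = 3" "clique_edges D \<subseteq> ?E" "D \<notin> Q'"
    have EV: "p \<in> V" "q \<in> V" if "{p, q} \<in> E" for p q using edge_cases[OF that] by auto
    have fD: "finite D" using D(2) card.infinite by fastforce
    show "\<exists>y z. y \<noteq> z \<and> (\<forall>c\<in>D. {y, c} \<in> ?E \<and> {z, c} \<in> ?E)"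
    proof (cases "w \<in> D")
      \<comment> \<open>All neighbours of \<open>w\<close> are in \<open>C\<close>, so a 3-clique
        through \<open>w\<close> is one of the new open cliques.\<close>
      case True
      have "a \<in> C" if "a \<in> D" "a \<noteq> w" for a
      proof -
        have "{w, a} \<in> clique_edges D" using True that by (simp add: clique_edges_def)
        then have "{w, a} \<in> ?E" using D(3) by blast
        then show ?thesis using EV[of w a] wV that by (auto simp: doubleton_eq_iff)
      qed
      then have sub: "D - {w} \<subseteq> C" by auto
      have "card (D - {w}) = 2" using D(2) True fD by simp
      then have "card (C - (D - {w})) = 1" using sub C(2) fC fD by (simp add: card_Diff_subset)
      then obtain c where c: "C - (D - {w}) = {c}" using card_1_singletonE by blast
      have cC: "c \<in> C" using c by blast
      have "D - {w} = C - {c}" using sub c by blast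
      then have "D = nw c" using True unfolding nw_def by blast
      then have "D \<in> Q'" using cC unfolding Q'_def nw_def by blast
      then show ?thesis using D(4) by blast
    next
      case False
      then have DV: "D \<subseteq> V" using D(1) by auto
      have "clique_edges D \<subseteq> E"
      proof
        fix e assume e: "e \<in> clique_edges D"
        then have "w \<notin> e" using False by (auto simp: clique_edges_def)
        then show "e \<in> E" using e D(3) by blast
      qed
      then show ?thesis
      proof (cases "D \<in> Q")
        \<comment> \<open>This is the clique just filled: its earlier common neighbour and
          \<open>w\<close> are the two that are needed.\<close>
        case True
        then have "D = C" "sh C \<noteq> {}" using D(4) X_def by (auto simp: Q'_def)
        then obtain y where y: "\<forall>c\<in>D. {y, c} \<in> E" using open_nbr[OF True] by auto
        obtain c0 where "c0 \<in> D" using D(2) by fastforce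
        then have "y \<noteq> w" using y EV wV by blast
        then show ?thesis using y \<open>D = C\<close> by (intro exI[of _ y] exI[of _ w]) auto
      next
        case False
        then show ?thesis using closed_nbrs[OF DV D(2) \<open>clique_edges D \<subseteq> E\<close>] by blast
      qed
    qed
  next
    fix D assume D: "D \<in> Q'" and s: "sh' D \<noteq> {}"
    \<comment> \<open>The omitted vertex \<open>c\<close> is adjacent to \<open>w\<close> and to the
      rest of \<open>C\<close>.\<close>
    have new: "\<exists>y. \<forall>c\<in>D. {y, c} \<in> ?E" if c: "c \<in> C" "D = nw c" for c
    proof (intro exI[of _ c] ballI)
      fix a assume a: "a \<in> D"
      show "{c, a} \<in> ?E"
      proof (cases "a = w")
        case True
        then show ?thesis using c(1) by (auto simp: insert_commute)
      next
        case False
        then have "a \<in> C" "a \<noteq> c" using a c by (auto simp: nw_def)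
        then have "{c, a} \<in> clique_edges C" using c by (simp add: clique_edges_def)
        then show ?thesis using clq by blast
      qed
    qed
    show "\<exists>y. \<forall>c\<in>D. {y, c} \<in> ?E" using D
      by (rule Q'E) (use open_nbr[of D] old_sh[of D] s new in blast)+
  next
    fix \<delta> assume "\<delta> \<notin> U'"
    then have "\<delta> \<notin> U" "\<delta> \<noteq> \<beta>" "card X = 2 \<Longrightarrow> \<delta> \<noteq> \<gamma>" using C(3) by (auto simp: U'_def split: if_splits)
    then show "P' \<delta> = {} \<and> T' \<delta> = {} \<and> Ed' \<delta> = {} \<and> K' \<delta> = {}"
      using unused[of \<delta>] by (auto simp: P'_def T'_def Ed'_def K'_def)
  next
    fix m' k' \<delta> assume a: "(m', k') # \<delta> \<in> U'"
    show "k' \<in> snd ` P' \<delta>"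
    proof (cases "(m', k') # \<delta> \<in> U")
      case True
      then show ?thesis using used[OF True] by (auto simp: P'_def)
    next
      case False
      then have "(m', k') # \<delta> = \<gamma>" using a by (auto simp: U'_def split: if_splits)
      then show ?thesis by (auto simp: \<gamma>_def P'_def)
    qed
  qed
  then show ?thesis by blast
qed

text \<open>The root bag holds just the base triangle, on levels 0, 1, 2, and has no gaps. All later
  vertices start from its child bag \<open>\<gamma>\<close>, whose empty gap is renewed at each use,
  so the base triangle can receive vertices on both sides.\<close>

lemma bagging_base:
  assumes V: "card (V :: 'a set) = 3"
  shows "\<exists>b pt t lo hi Q P T Ed K U. bagging V (clique_edges V) b pt t lo hi Q P T Ed K U"
proof -
  obtain v0 v1 v2 where v: "V = {v0, v1, v2}" "v0 \<noteq> v1" "v0 \<noteq> v2" "v1 \<noteq> v2"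
    using V by (auto simp: card_3_iff)
  define pt where "pt = (\<lambda>v. (if v = v0 then 0 else if v = v1 then 1 else 2 :: nat, 0 :: real))"
  define \<gamma> :: bag where "\<gamma> = [(0, 0)]"
  define P where "P = (\<lambda>\<beta>::bag. if \<beta> = [] then pt ` V else {})"
  define T :: "bag \<Rightarrow> gap set" where "T = (\<lambda>\<beta>. if \<beta> = \<gamma> then {({}, 0, 1)} else {})"
  define Ed where "Ed = (\<lambda>\<beta>::bag. if \<beta> = [] then pt ` V \<times> pt ` V else {})"
  define K where "K = (\<lambda>\<beta>::bag. if \<beta> = [] then pt ` V \<times> {0::real} else {})"
  have gne: "\<gamma> \<noteq> []" by (simp add: \<gamma>_def)
  have ptV: "snd p = 0" if "p \<in> pt ` V" for p using that by (auto simp: pt_def)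
  have G0: "good (pt ` V) {} (pt ` V \<times> pt ` V) (pt ` V \<times> {0})"
  proof -
    have "\<not> snd p < snd p'" "0 \<in> snd ` pt ` V" if "p \<in> pt ` V" "p' \<in> pt ` V" for p p'
      using ptV that by (simp, metis imageI)
    then show ?thesis unfolding good_def ball_pair mem_Sigma_iff by blast
  qed
  have GE: "good {} {} {} {}" unfolding good_def by simp
  have "bagging V (clique_edges V) (\<lambda>_. []) pt (\<lambda>_. \<gamma>) (\<lambda>_. 0) (\<lambda>_. 1) {V} P T Ed K {[], \<gamma>}"
  proof
    fix \<beta>
    show "good (P \<beta>) (T \<beta>) (Ed \<beta>) (K \<beta>)"
      using G0 GE good_init gne unfolding P_def T_def Ed_def K_def by simp
  next
    fix p q assume "{p, q} \<in> clique_edges V"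
    then have pq: "p \<in> V" "q \<in> V" "p \<noteq> q" by (auto simp: clique_edges_def)
    then have "near (fst (pt p)) (fst (pt q))" using v by (auto simp: pt_def near_def)
    then show "p \<in> V \<and> q \<in> V \<and> (([]::bag) = [] \<and> near (fst (pt p)) (fst (pt q)) \<and> (pt p, pt q) \<in> Ed [] \<or>
      (\<exists>D\<in>{V}. {c \<in> D. [] = \<gamma>} = {} \<and> (\<gamma> = [] \<and> p \<in> D \<or> \<gamma> = [] \<and> q \<in> D)))"
      using pq by (auto simp: Ed_def)
  next
    fix C assume "C \<subseteq> V" "card C = 3" "C \<notin> {V}"
    then show "\<exists>y z. y \<noteq> z \<and> (\<forall>c\<in>C. {y, c} \<in> clique_edges V \<and> {z, c} \<in> clique_edges V)"
      using V card_subset_eq[of V C] card.infinite[of V] by fastforce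
  next
    fix D assume "D \<in> {V}"
    have "\<forall>p\<in>D. ([]::bag) = [] \<and> (0::nat) \<le> fst (pt p) \<and> fst (pt p) \<le> 0 + 2 \<and> (pt p, 0) \<in> K []"
      using \<open>D \<in> {V}\<close> by (auto simp: pt_def K_def)
    then show "\<exists>m k \<beta>. \<gamma> = (m, k) # \<beta> \<and>
          (\<forall>p\<in>D. [] = \<beta> \<and> m \<le> fst (pt p) \<and> fst (pt p) \<le> m + 2 \<and> (pt p, k) \<in> K \<beta>)"
      unfolding \<gamma>_def by (intro exI[of _ 0] exI[of _ "[]"]) auto
  next
    show "\<And>v v'. v \<in> V \<Longrightarrow> v' \<in> V \<Longrightarrow> pt v = pt v' \<Longrightarrow> v = v'"
      using v by (auto simp: pt_def split: if_splits)
  next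
    fix m k \<beta> assume "(m, k) # \<beta> \<in> {[], \<gamma>}"
    then show "k \<in> snd ` P \<beta>" using v by (auto simp: \<gamma>_def P_def pt_def)
  qed (use V gne in \<open>auto simp: P_def T_def Ed_def K_def\<close>)
  then show ?thesis by blast
qed

definition no_K33 :: "'a set set \<Rightarrow> bool" where
  "no_K33 E \<longleftrightarrow> (\<nexists>C x y z. card C = 3 \<and> x \<noteq> y \<and> x \<noteq> z \<and> y \<noteq> z \<and>
     (\<forall>c\<in>C. {x, c} \<in> E \<and> {y, c} \<in> E \<and> {z, c} \<in> E))"

lemma bagging_exists:
  assumes "ktree 3 (V :: 'a set) E" and "no_K33 E"
  shows "\<exists>b pt t lo hi Q P T Ed K U. bagging V E b pt t lo hi Q P T Ed K U"
  using assms
proof (induction rule: ktree.induct)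
  case (base V)
  then show ?case using bagging_base by blast
next
  case (step V E v C)
  have "no_K33 E" using step.prems unfolding no_K33_def by blast
  then obtain b pt t lo hi Q P T Ed K U where B: "bagging V E b pt t lo hi Q P T Ed K U"
    using step.IH by blast
  interpret bagging V E b pt t lo hi Q P T Ed K U "\<lambda>C. {c \<in> C. b c = t C}" by (fact B)
  \<comment> \<open>A clique that has left \<open>Q\<close> has two common neighbours already;
    \<open>v\<close> would be the third.\<close>
  have "C \<in> Q"
  proof (rule ccontr)
    assume "C \<notin> Q"
    then obtain y z where yz: "y \<noteq> z" "\<forall>c\<in>C. {y, c} \<in> E \<and> {z, c} \<in> E"
      using closed_nbrs step.hyps by blast
    obtain c0 where "c0 \<in> C" using step.hyps by fastforce
    then have "y \<in> V" "z \<in> V" using yz edge_cases[of y c0] edge_cases[of z c0] by auto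
    then have "y \<noteq> v" "z \<noteq> v" using step.hyps by auto
    then show False using step.prems yz step.hyps unfolding no_K33_def by blast
  qed
  then show ?case using extend step.hyps by blast
qed

subsection \<open>Wrapping\<close>

text \<open>Triangles of lowest level \<open>m\<close> with the same \<open>col m\<close> and the same \<open>m div 5\<close> live in a window of at most
  five levels, so their order survives wrapping the levels modulo 5.\<close>

definition col :: "nat \<Rightarrow> nat" where
  "col m = (if m mod 5 < 2 then 1 else 2)"

text \<open>Recursing on the tail before comparing the heads makes bags ordered like their parents,
  provided the steps from the parents have the same colour.\<close>

fun bag_less :: "bag \<Rightarrow> bag \<Rightarrow> bool" where
  "bag_less _ [] = False"
| "bag_less [] (_ # _) = True"
| "bag_less ((m, k) # \<beta>) ((m', k') # \<beta>') =
     (col m < col m' \<or> col m = col m' \<and> (bag_less \<beta> \<beta>' \<or> \<beta> = \<beta>' \<and>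
       (m div 5 < m' div 5 \<or> m div 5 = m' div 5 \<and> (k < k' \<or> k = k' \<and> m < m'))))"

lemma bag_less_irrefl: "\<not> bag_less \<beta> \<beta>"
  by (induction \<beta>) auto

lemma bag_less_trans: "bag_less \<beta> \<beta>' \<Longrightarrow> bag_less \<beta>' \<beta>'' \<Longrightarrow> bag_less \<beta> \<beta>''"
proof (induction \<beta> \<beta>' arbitrary: \<beta>'' rule: bag_less.induct)
  case (3 m k \<beta> m' k' \<beta>')
  obtain m'' k'' \<gamma> where g: "\<beta>'' = (m'', k'') # \<gamma>" using 3(3) by (cases \<beta>'') auto
  have IH: "col m = col m' \<Longrightarrow> bag_less \<beta> \<beta>' \<Longrightarrow> bag_less \<beta>' \<gamma> \<Longrightarrow> bag_less \<beta> \<gamma>" using 3(1) by auto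
  show ?case
  proof (cases "col m = col m' \<and> col m' = col m''")
    case True
    then show ?thesis using 3(2,3) IH unfolding g by auto
  next
    case False
    then show ?thesis using 3(2,3) unfolding g by auto
  qed
next
  case (2 v va)
  then show ?case by (cases \<beta>'') auto
qed simp

lemma bag_less_total: "\<beta> \<noteq> \<beta>' \<Longrightarrow> bag_less \<beta> \<beta>' \<or> bag_less \<beta>' \<beta>"
proof (induction \<beta> \<beta>' rule: bag_less.induct)
  case (1 \<beta>)
  then show ?case by (cases \<beta>) auto
next
  case (3 m k \<beta> m' k' \<beta>')
  then show ?case by auto
qed auto

definition bag_pos :: "bag \<Rightarrow> nat" where
  "bag_pos \<beta> = sum_list (map (col \<circ> fst) \<beta>)"

lemma bag_pos_Cons: "bag_pos ((m, k) # \<beta>) = bag_pos \<beta> + col m"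
  by (simp add: bag_pos_def)

lemma col_cases: "col m = 1 \<or> col m = 2"
  by (simp add: col_def)

text \<open>With \<open>q = m div 5\<close>, colour 1 confines the triangle to the levels from
  \<open>5 * q\<close> to \<open>5 * q + 3\<close>, colour 2 to those from \<open>5 * q + 2\<close>
  to \<open>5 * q + 6\<close>. Either way two levels of the window differ by less than 5. Windows of
  one colour with different \<open>q\<close> are disjoint, which is behind
  \<open>window_less\<close>.\<close>

lemma window_eq:
  assumes "col m = col m'" "m div 5 = m' div 5" "m \<le> l" "l \<le> m + 2" "m' \<le> l'" "l' \<le> m' + 2" "l mod 5 = l' mod 5"
  shows "l = l'"
proof -
  define q r r' where "q = m div 5" and "r = m mod 5" and "r' = m' mod 5"
  have q: "m = 5 * q + r" "r < 5" "r' < 5" by (simp_all add: q_def r_def r'_def)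
  have q': "m' = 5 * q + r'" by (simp add: assms(2) q_def r'_def)
  have c: "(r < 2) = (r' < 2)" using assms(1) by (auto simp: col_def r_def r'_def split: if_splits)
  have "int l mod 5 = int l' mod 5" using assms(7) by (metis of_nat_mod of_nat_numeral)
  then have "(int l - int l') mod 5 = 0" by (simp add: mod_eq_dvd_iff)
  moreover have "\<bar>int l - int l'\<bar> < 5" using c q q' assms(3-6) by (cases "r < 2") auto
  ultimately show ?thesis by presburger
qed

lemma window_less:
  assumes "col m = col m'" "m' div 5 < m div 5" "m \<le> l" "l \<le> m + 2" "m' \<le> l'" "l' \<le> m' + 2" "l mod 5 = l' mod 5"
  shows "l' < l"
proof -
  define q r q' r' where "q = m div 5" and "r = m mod 5" and "q' = m' div 5" and "r' = m' mod 5"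
  have q: "m = 5 * q + r" "r < 5" and q': "m' = 5 * q' + r'" "r' < 5"
    by (simp_all add: q_def r_def q'_def r'_def)
  have qq: "q' + 1 \<le> q" using assms(2) by (simp add: q_def q'_def)
  have c: "(r < 2) = (r' < 2)" using assms(1) by (auto simp: col_def r_def r'_def split: if_splits)
  have "int l mod 5 = int l' mod 5" using assms(7) by (metis of_nat_mod of_nat_numeral)
  then have m: "(int l - int l') mod 5 = 0" by (simp add: mod_eq_dvd_iff)
  have "int l - int l' > - 5" "int l \<noteq> int l'" using c q q' qq assms(3-6) by (cases "r < 2"; linarith)+
  then show ?thesis using m by presburger
qed

text \<open>Layers that wrap onto the same track are put one after another: the unwrapped bag
  position is compared before the bag, and the unwrapped level before the abscissa.\<close>

definition vertex_less :: "('a \<Rightarrow> bag) \<Rightarrow> ('a \<Rightarrow> point) \<Rightarrow> 'a \<Rightarrow> 'a \<Rightarrow> bool" where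
  "vertex_less b pt u v \<longleftrightarrow> bag_pos (b u) < bag_pos (b v) \<or> bag_pos (b u) = bag_pos (b v) \<and>
     (bag_less (b u) (b v) \<or> b u = b v \<and>
       (fst (pt u) < fst (pt v) \<or> fst (pt u) = fst (pt v) \<and> snd (pt u) < snd (pt v)))"

definition track_of :: "('a \<Rightarrow> bag) \<Rightarrow> ('a \<Rightarrow> point) \<Rightarrow> 'a \<Rightarrow> nat" where
  "track_of b pt v = 5 * (bag_pos (b v) mod 5) + fst (pt v) mod 5"

lemma track_of_eq:
  "track_of b pt u = track_of b pt v \<longleftrightarrow> bag_pos (b u) mod 5 = bag_pos (b v) mod 5 \<and> fst (pt u) mod 5 = fst (pt v) mod 5"
proof
  have digits: "a = a' \<and> r = r'" if "5 * a + r = 5 * a' + r'" "r < 5" "r' < 5" for a r a' r' :: nat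
    using that by presburger
  assume "track_of b pt u = track_of b pt v"
  then have "5 * (bag_pos (b u) mod 5) + fst (pt u) mod 5 = 5 * (bag_pos (b v) mod 5) + fst (pt v) mod 5"
    by (simp add: track_of_def)
  then show "bag_pos (b u) mod 5 = bag_pos (b v) mod 5 \<and> fst (pt u) mod 5 = fst (pt v) mod 5"
    by (rule digits) simp_all
qed (simp add: track_of_def)

lemma near_mod: "near m n \<Longrightarrow> m mod 5 \<noteq> n mod 5"
proof
  assume n: "near m n" and "m mod 5 = n mod 5"
  then have "int m mod 5 = int n mod 5" by (metis of_nat_mod of_nat_numeral)
  then have "(int m - int n) mod 5 = 0" by (simp add: mod_eq_dvd_iff)
  moreover have "int m - int n \<noteq> 0" "\<bar>int m - int n\<bar> < 5" using n unfolding near_def by linarith+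
  ultimately show False by presburger
qed

lemma near_shift:
  assumes "near m n" "near m' n'" "m mod 5 = m' mod 5" "n mod 5 = n' mod 5"
  shows "int n - int m = int n' - int m'"
proof -
  have "((int n - int m) - (int n' - int m')) mod 5 = 0"
  proof -
    have "int m mod 5 = int m' mod 5" "int n mod 5 = int n' mod 5"
      using assms(3,4) by (metis of_nat_mod of_nat_numeral)+
    then have "(int n - int m) mod 5 = (int n' - int m') mod 5" by (intro mod_diff_cong)
    then show ?thesis by (simp add: mod_eq_dvd_iff)
  qed
  moreover have "\<bar>(int n - int m) - (int n' - int m')\<bar> < 5" using assms(1,2) unfolding near_def by linarith
  ultimately show ?thesis by presburger
qed

section \<open>The layout on 25 tracks\<close>

context bagging
begin

definition parent :: "'a \<Rightarrow> 'a \<Rightarrow> bool" where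
  "parent p c \<longleftrightarrow> (\<exists>m k. b c = (m, k) # b p \<and> m \<le> fst (pt p) \<and> fst (pt p) \<le> m + 2 \<and> (pt p, k) \<in> K (b p))"

lemma edge_parent:
  assumes "{p, q} \<in> E"
  shows "b p = b q \<and> near (fst (pt p)) (fst (pt q)) \<and> (pt p, pt q) \<in> Ed (b p) \<or> parent p q \<or> parent q p"
proof -
  have "parent p q" if "D \<in> Q" "sh D = {}" "t D = b q" "p \<in> D" for D p q
    using root_level[OF that(1,2)] that(3,4) unfolding parent_def by metis
  then show ?thesis using edge_cases[OF assms] by blast
qed

lemma parent_pos: "parent p c \<Longrightarrow> bag_pos (b c) = bag_pos (b p) + 1 \<or> bag_pos (b c) = bag_pos (b p) + 2"
  unfolding parent_def using bag_pos_Cons col_cases by metis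

text \<open>Equal tracks force equal colours, and then equal bag positions. As children are ordered
  like their parents, \<open>u\<close> and \<open>x\<close> must share a bag. If their windows
  differ, the lower window would contain \<open>x\<close>, although \<open>u\<close> comes first. In
  a common window \<open>u\<close> and \<open>x\<close> are on the same level, and the marks put the
  triangle of \<open>v\<close> before that of \<open>y\<close>, although \<open>y\<close> comes
  first.\<close>

lemma parent_no_crossing:
  assumes p: "parent u v" "parent x y" and tr: "track_of b pt u = track_of b pt x" "track_of b pt v = track_of b pt y"
    and l: "vertex_less b pt u x" "vertex_less b pt y v"
  shows False
proof -
  obtain m k where v: "b v = (m, k) # b u" "m \<le> fst (pt u)" "fst (pt u) \<le> m + 2" "(pt u, k) \<in> K (b u)"
    using p(1) unfolding parent_def by blast
  obtain m' k' where y: "b y = (m', k') # b x" "m' \<le> fst (pt x)" "fst (pt x) \<le> m' + 2" "(pt x, k') \<in> K (b x)"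
    using p(2) unfolding parent_def by blast
  have bv: "bag_pos (b v) = bag_pos (b u) + col m" "bag_pos (b y) = bag_pos (b x) + col m'"
    using v y bag_pos_Cons by auto
  have md: "bag_pos (b u) mod 5 = bag_pos (b x) mod 5" "bag_pos (b v) mod 5 = bag_pos (b y) mod 5"
     "fst (pt u) mod 5 = fst (pt x) mod 5" using tr unfolding track_of_eq by blast+
  have cm: "col m = col m'"
  proof -
    have "near (bag_pos (b u)) (bag_pos (b v))" "near (bag_pos (b x)) (bag_pos (b y))"
      using bv col_cases[of m] col_cases[of m'] by (auto simp: near_def)
    then show ?thesis using near_shift[OF _ _ md(1,2)] bv by simp
  qed
  have a: "bag_pos (b u) = bag_pos (b x)" using l bv cm unfolding vertex_less_def by linarith
  then have a': "bag_pos (b v) = bag_pos (b y)" using bv cm by simp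
  have yv: "bag_less (b y) (b v) \<or> b y = b v" using l(2) a' unfolding vertex_less_def by auto
  have "\<not> bag_less (b u) (b x)"
  proof
    assume "bag_less (b u) (b x)"
    then have "bag_less (b v) (b y)" using v y cm by simp
    then show False using yv bag_less_trans bag_less_irrefl by metis
  qed
  then have bb: "b u = b x" and ux: "fst (pt u) < fst (pt x) \<or> fst (pt u) = fst (pt x) \<and> snd (pt u) < snd (pt x)"
    using l(1) a unfolding vertex_less_def by auto
  have tt: "m' div 5 < m div 5 \<or> m' div 5 = m div 5 \<and> k' \<le> k"
    using yv v y bb cm bag_less_irrefl by auto
  then show False
  proof
    assume "m' div 5 < m div 5"
    then have "fst (pt x) < fst (pt u)" using window_less[OF cm _ v(2,3) y(2,3)] md by simp
    then show False using ux by simp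
  next
    assume q: "m' div 5 = m div 5 \<and> k' \<le> k"
    then have "fst (pt u) = fst (pt x)" using window_eq[OF cm _ v(2,3) y(2,3)] md by simp
    then have "k < k'" using good_mark_mark[OF good v(4), of "pt x" k'] y(4) ux bb by auto
    then show False using q by simp
  qed
qed

lemma track_layout_25:
  "track_layout V E 25 (track_of b pt) (\<lambda>_. {(u, v). vertex_less b pt u v})"
proof -
  have md: "bag_pos (b c) mod 5 \<noteq> bag_pos (b p) mod 5" if "parent p c" for p c
    using parent_pos[OF that] near_mod[of "bag_pos (b c)" "bag_pos (b p)"] unfolding near_def by blast
  have trans: "vertex_less b pt u w" if "vertex_less b pt u v" "vertex_less b pt v w" for u v w
  proof (cases "bag_pos (b u) = bag_pos (b v) \<and> bag_pos (b v) = bag_pos (b w)")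
    case eq: True
    show ?thesis
    proof (cases "b u = b v \<and> b v = b w")
      case True
      then show ?thesis using that bag_less_irrefl unfolding vertex_less_def by auto
    next
      case False
      then have "bag_less (b u) (b w)"
        using that eq bag_less_trans[of "b u" "b v" "b w"] unfolding vertex_less_def by (metis less_irrefl)
      then show ?thesis using eq unfolding vertex_less_def by simp
    qed
  next
    case False
    then have "bag_pos (b u) < bag_pos (b w)" using that unfolding vertex_less_def by linarith
    then show ?thesis unfolding vertex_less_def by simp
  qed
  have irr: "\<not> vertex_less b pt u u" for u
    using bag_less_irrefl unfolding vertex_less_def by auto
  have tot: "vertex_less b pt u v \<or> vertex_less b pt v u" if "u \<in> V" "v \<in> V" "u \<noteq> v" for u v
  proof (rule ccontr)
    assume n: "\<not> ?thesis"
    have "b u = b v" using n bag_less_total[of "b u" "b v"] unfolding vertex_less_def by (metis linorder_neqE_nat)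
    moreover have "pt u = pt v" using n calculation unfolding vertex_less_def
      by (metis linorder_neqE_nat linorder_neqE_linordered_idom prod.expand)
    ultimately show False using pt_inj that by blast
  qed
  have "track_assignment V E 25 (track_of b pt) (\<lambda>_. {(u, v). vertex_less b pt u v})"
    unfolding track_assignment_def
  proof (intro conjI ballI allI impI)
    fix v
    show "track_of b pt v < 25"
      unfolding track_of_def using mod_less_divisor[of 5 "bag_pos (b v)"] mod_less_divisor[of 5 "fst (pt v)"] by linarith
  next
    fix u v assume "{u, v} \<in> E"
    then show "track_of b pt u \<noteq> track_of b pt v"
      using edge_parent[of u v] near_mod md track_of_eq[of b pt u v] by metis
  next
    fix i :: nat
    show "strict_linear_order_on {v \<in> V. track_of b pt v = i} {(u, v). vertex_less b pt u v}"
      unfolding strict_linear_order_on_def trans_def irrefl_def total_on_def using trans irr tot by blast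
  qed
  moreover have "\<not> x_crossing E (track_of b pt) (\<lambda>_. {(u, v). vertex_less b pt u v})"
  proof
    assume "x_crossing E (track_of b pt) (\<lambda>_. {(u, v). vertex_less b pt u v})"
    then obtain u v x y where e: "{u, v} \<in> E" "{x, y} \<in> E" and t: "track_of b pt u = track_of b pt x"
      "track_of b pt v = track_of b pt y" and l: "vertex_less b pt u x" "vertex_less b pt y v"
      unfolding x_crossing_def by auto
    have m: "bag_pos (b u) mod 5 = bag_pos (b x) mod 5" "bag_pos (b v) mod 5 = bag_pos (b y) mod 5"
      "fst (pt u) mod 5 = fst (pt x) mod 5" "fst (pt v) mod 5 = fst (pt y) mod 5"
      using t unfolding track_of_eq by blast+
    have same: False if "b u = b v" "near (fst (pt u)) (fst (pt v))" "(pt u, pt v) \<in> Ed (b u)"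
       "b x = b y" "near (fst (pt x)) (fst (pt y))" "(pt x, pt y) \<in> Ed (b x)"
    proof -
      have "bag_pos (b u) = bag_pos (b x)" using l that unfolding vertex_less_def by auto
      then have "b u = b x" using l that bag_less_trans bag_less_irrefl unfolding vertex_less_def by (metis less_irrefl)
      then have 1: "fst (pt u) < fst (pt x) \<or> fst (pt u) = fst (pt x) \<and> snd (pt u) < snd (pt x)"
        and 2: "fst (pt y) < fst (pt v) \<or> fst (pt y) = fst (pt v) \<and> snd (pt y) < snd (pt v)"
        using l that bag_less_irrefl unfolding vertex_less_def by auto
      have "int (fst (pt v)) - int (fst (pt u)) = int (fst (pt y)) - int (fst (pt x))"
        using near_shift[OF that(2,5) m(3,4)] .
      then have "fst (pt u) = fst (pt x)" "fst (pt v) = fst (pt y)" using 1 2 by linarith+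
      then show False using good_edge_edge[OF good that(3), of "pt x" "pt y"] that(6) \<open>b u = b x\<close> 1 2 by auto
    qed
    \<comment> \<open>Here one edge goes up and the other down in bag position, so their signed
      spans differ in sign.\<close>
    have opp: False if "parent u v \<and> parent y x \<or> parent v u \<and> parent x y"
    proof -
      have "near (bag_pos (b u)) (bag_pos (b v))" "near (bag_pos (b x)) (bag_pos (b y))"
        using that parent_pos unfolding near_def by blast+
      then have "int (bag_pos (b v)) - int (bag_pos (b u)) = int (bag_pos (b y)) - int (bag_pos (b x))"
        using near_shift m(1,2) by blast
      then show False
        using that parent_pos[of u v] parent_pos[of y x] parent_pos[of v u] parent_pos[of x y] by auto
    qed
    \<comment> \<open>An edge inside a bag keeps the residue of the bag position, an edge to a child
      changes it.\<close>
    have mixed: False if "b u = b v \<and> (parent x y \<or> parent y x) \<or> b x = b y \<and> (parent u v \<or> parent v u)"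
      using that m(1,2) md by metis
    show False
      using edge_parent[OF e(1)] edge_parent[OF e(2)] same opp mixed
        parent_no_crossing[of u v x y] parent_no_crossing[of y x v u] t l by metis
  qed
  ultimately show ?thesis unfolding track_layout_def by blast
qed

end

lemma track_number_le_25:
  assumes "ktree 3 V E" "no_K33 E"
  shows "track_number V E \<le> 25"
proof -
  obtain b pt t lo hi Q P T Ed K U where B: "bagging V E b pt t lo hi Q P T Ed K U"
    using bagging_exists[OF assms] by blast
  then have "\<exists>tr ord. track_layout V E 25 tr ord" using bagging.track_layout_25 by blast
  then show ?thesis unfolding track_number_def by (rule Least_le)
qed

subsection \<open>Planarity excludes the complete bipartite graph on 3 + 3 vertices\<close>

definition K33_drawing :: "(nat \<Rightarrow> complex) \<Rightarrow> (nat \<Rightarrow> complex) \<Rightarrow> (nat \<Rightarrow> nat \<Rightarrow> real \<Rightarrow> complex) \<Rightarrow> bool" where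
  "K33_drawing A B g \<longleftrightarrow>
     (\<forall>i<3. \<forall>j<3. arc (g i j) \<and> pathstart (g i j) = A i \<and> pathfinish (g i j) = B j) \<and>
     (\<forall>i<3. \<forall>j<3. \<forall>i'<3. \<forall>j'<3. (i, j) \<noteq> (i', j') \<longrightarrow>
        path_image (g i j) \<inter> path_image (g i' j') \<subseteq> (if i = i' then {A i} else {}) \<union> (if j = j' then {B j} else {}))"

lemma K33_drawingD:
  assumes "K33_drawing A B g" "i < 3" "j < 3"
  shows "arc (g i j)" "pathstart (g i j) = A i" "pathfinish (g i j) = B j"
    "A i \<in> path_image (g i j)" "B j \<in> path_image (g i j)"
proof -
  show *: "arc (g i j)" "pathstart (g i j) = A i" "pathfinish (g i j) = B j"
    using assms unfolding K33_drawing_def by blast+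
  show "A i \<in> path_image (g i j)" "B j \<in> path_image (g i j)"
    using pathstart_in_path_image[of "g i j"] pathfinish_in_path_image[of "g i j"] * by auto
qed

lemma K33_drawing_Int:
  assumes "K33_drawing A B g" "i < 3" "j < 3" "i' < 3" "j' < 3" "(i, j) \<noteq> (i', j')"
    "w \<in> path_image (g i j)" "w \<in> path_image (g i' j')"
  shows "i = i' \<and> w = A i \<or> j = j' \<and> w = B j"
proof -
  have "w \<in> (if i = i' then {A i} else {}) \<union> (if j = j' then {B j} else {})"
    using assms unfolding K33_drawing_def by blast
  then show ?thesis by (auto split: if_splits)
qed

text \<open>Arcs that share no index are disjoint. A coincidence of two end points would put the
  common point on two such arcs.\<close>

lemma K33_drawing_distinct:
  assumes "K33_drawing A B g" "i < 3" "j < 3"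
  shows "A i \<noteq> B j" "j' < 3 \<Longrightarrow> B j = B j' \<Longrightarrow> j = j'"
proof -
  obtain i2 where i2: "i2 < 3" "i2 \<noteq> i" using that[of "if i = 0 then 1 else 0"] by simp
  obtain j2 where j2: "j2 < 3" "j2 \<noteq> j" using that[of "if j = 0 then 1 else 0"] by simp
  show "A i \<noteq> B j"
    using K33_drawing_Int[OF assms(1), of i j2 i2 j "A i"] K33_drawingD[OF assms(1) assms(2) j2(1)]
      K33_drawingD[OF assms(1) i2(1) assms(3)] i2 j2 assms by auto
  show "j' < 3 \<Longrightarrow> B j = B j' \<Longrightarrow> j = j'"
    using K33_drawing_Int[OF assms(1), of i j i2 j' "B j"] K33_drawingD[OF assms(1) assms(2,3)]
      K33_drawingD[OF assms(1), of i2 j'] i2 assms by auto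
qed

text \<open>The quadrilateral through \<open>A 0\<close>, \<open>B 0\<close>, \<open>A 1\<close>,
  \<open>B 1\<close>.\<close>

definition square :: "(nat \<Rightarrow> nat \<Rightarrow> real \<Rightarrow> complex) \<Rightarrow> complex set" where
  "square g = path_image (g 0 0) \<union> path_image (g 0 1) \<union> path_image (g 1 0) \<union> path_image (g 1 1)"

lemma K33_theta_arc:
  assumes D: "K33_drawing A B g" and i: "i < 3"
  shows "arc (reversepath (g i 0) +++ g i 1)" "pathstart (reversepath (g i 0) +++ g i 1) = B 0"
    "pathfinish (reversepath (g i 0) +++ g i 1) = B 1"
    "path_image (reversepath (g i 0) +++ g i 1) = path_image (g i 0) \<union> path_image (g i 1)"
proof -
  note d = K33_drawingD[OF D i, of 0] K33_drawingD[OF D i, of 1]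
  show "arc (reversepath (g i 0) +++ g i 1)"
  proof (rule arc_join)
    show "path_image (reversepath (g i 0)) \<inter> path_image (g i 1) \<subseteq> {pathstart (g i 1)}"
    proof
      fix w assume "w \<in> path_image (reversepath (g i 0)) \<inter> path_image (g i 1)"
      then have "w = A i" using K33_drawing_Int[OF D i _ i, of 0 1 w] by simp
      then show "w \<in> {pathstart (g i 1)}" using d by simp
    qed
  qed (use d in \<open>auto simp: arc_reversepath\<close>)
  show "pathstart (reversepath (g i 0) +++ g i 1) = B 0" "pathfinish (reversepath (g i 0) +++ g i 1) = B 1"
    "path_image (reversepath (g i 0) +++ g i 1) = path_image (g i 0) \<union> path_image (g i 1)"
    using d by (auto simp: path_image_join)
qed

lemma K33_theta_Int:
  assumes D: "K33_drawing A B g" and i: "i < 3" "i' < 3" "i \<noteq> i'"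
  shows "(path_image (g i 0) \<union> path_image (g i 1)) \<inter> (path_image (g i' 0) \<union> path_image (g i' 1)) = {B 0, B 1}"
proof -
  have "w = B 0 \<or> w = B 1" if "w \<in> path_image (g i j)" "w \<in> path_image (g i' j')" "j = 0 \<or> j = 1" "j' = 0 \<or> j' = 1" for w j j'
    using K33_drawing_Int[OF D i(1) _ i(2) _ _ that(1,2)] that i(3) by auto
  then show ?thesis
    using K33_drawingD(5)[OF D i(1), of 0] K33_drawingD(5)[OF D i(1), of 1]
      K33_drawingD(5)[OF D i(2), of 0] K33_drawingD(5)[OF D i(2), of 1] by auto
qed

lemma connected_inside:
  assumes "connected T" "T \<inter> S = {}" "u \<in> T" "v \<in> T" "u \<in> inside S"
  shows "v \<in> inside S"
  using inside_outside_intersect_connected[OF assms(1), of S] inside_Un_outside[of S] assms by blast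

text \<open>Three paths through \<open>A 0\<close>, \<open>A 1\<close>, \<open>A 2\<close> join \<open>B 0\<close> to \<open>B 1\<close>. If the third runs inside the other two,
  then \<open>B 2\<close> lies in a face that misses \<open>A 0\<close> or \<open>A 1\<close>.\<close>

lemma K33_not_inside:
  assumes D: "K33_drawing A B g" and ins: "A 2 \<in> inside (square g)"
  shows False
proof -
  define \<Theta> where "\<Theta> i = reversepath (g i 0) +++ g i 1" for i
  note th = K33_theta_arc[OF D, folded \<Theta>_def]
  have im: "path_image (\<Theta> i) = path_image (g i 0) \<union> path_image (g i 1)" if "i < 3" for i using th that by blast
  have sq: "square g = path_image (\<Theta> 0) \<union> path_image (\<Theta> 1)" 
    using im[of 0] im[of 1] unfolding square_def by (simp add: Un_assoc)
  have ti: "path_image (\<Theta> i) \<inter> path_image (\<Theta> i') = {B 0, B 1}" if "i < 3" "i' < 3" "i \<noteq> i'" for i i'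
    using K33_theta_Int[OF D that] im that by simp
  have B01: "B 0 \<noteq> B 1" using K33_drawing_distinct(2)[OF D, of 0 0 1] by auto
  have A2: "A 2 \<in> path_image (\<Theta> 2)" using im[of 2] K33_drawingD(4)[OF D, of 2 0] by auto
  \<comment> \<open>The theta curve: the path through \<open>A 2\<close> cuts the inside of the
    quadrilateral into two faces.\<close>
  obtain spl: "inside (path_image (\<Theta> 0) \<union> path_image (\<Theta> 2)) \<union> inside (path_image (\<Theta> 1) \<union> path_image (\<Theta> 2)) \<union>
           (path_image (\<Theta> 2) - {B 0, B 1}) = inside (path_image (\<Theta> 0) \<union> path_image (\<Theta> 1))"
  proof (rule split_inside_simple_closed_curve[of "\<Theta> 0" "B 0" "B 1" "\<Theta> 1" "\<Theta> 2"])
    show "path_image (\<Theta> 2) \<inter> inside (path_image (\<Theta> 0) \<union> path_image (\<Theta> 1)) \<noteq> {}"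
      using A2 ins sq by auto
  qed (use th ti B01 in \<open>auto intro: arc_imp_simple_path\<close>)
  have sub: "inside (path_image (\<Theta> 0) \<union> path_image (\<Theta> 2)) \<subseteq> inside (square g)"
    "inside (path_image (\<Theta> 1) \<union> path_image (\<Theta> 2)) \<subseteq> inside (square g)"
    unfolding sq spl[symmetric] by blast+
  have arc2: "path_image (g k 2) \<inter> path_image (\<Theta> i) = {}" if "k < 3" "i < 3" "k \<noteq> i" for k i
  proof -
    have False if "w \<in> path_image (g k 2)" "w \<in> path_image (g i j)" "j = 0 \<or> j = 1" for w j
      using K33_drawing_Int[OF D \<open>k < 3\<close> _ \<open>i < 3\<close> _ _ that(1,2)] that \<open>k \<noteq> i\<close> by auto
    then show ?thesis using im[OF that(2)] by blast
  qed
  have con: "connected (path_image (g k 2))" if "k < 3" for k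
    using K33_drawingD(1)[OF D that, of 2] connected_arc_image by auto
  have ends: "A k \<in> path_image (g k 2)" "B 2 \<in> path_image (g k 2)" if "k < 3" for k
    using K33_drawingD(4,5)[OF D that, of 2] by auto
  have "B 2 \<in> inside (square g)"
    by (rule connected_inside[OF con[of 2], of _ "A 2"]) (use ends[of 2] ins arc2[of 2 0] arc2[of 2 1] sq in auto)
  moreover have "B 2 \<notin> path_image (\<Theta> 2)" using arc2[of 0 2] ends[of 0] by auto
  ultimately have "B 2 \<in> inside (path_image (\<Theta> 0) \<union> path_image (\<Theta> 2)) \<union>
      inside (path_image (\<Theta> 1) \<union> path_image (\<Theta> 2)) \<union> (path_image (\<Theta> 2) - {B 0, B 1})"
    and B2: "B 2 \<notin> path_image (\<Theta> 2)" unfolding spl sq by blast+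
  then consider "B 2 \<in> inside (path_image (\<Theta> 0) \<union> path_image (\<Theta> 2))"
    | "B 2 \<in> inside (path_image (\<Theta> 1) \<union> path_image (\<Theta> 2))" by blast
  then show False
  proof cases
    case 1
    \<comment> \<open>The arc from \<open>B 2\<close> to \<open>A 1\<close> misses the boundary of
      this face, so it drags \<open>A 1\<close> into the inside of the quadrilateral on which
      \<open>A 1\<close> lies.\<close>
    have "A 1 \<in> inside (path_image (\<Theta> 0) \<union> path_image (\<Theta> 2))"
      by (rule connected_inside[OF con[of 1] _ _ _ 1]) (use ends[of 1] arc2[of 1 0] arc2[of 1 2] in auto)
    then have "A 1 \<in> inside (square g)" using sub by blast
    moreover have "A 1 \<in> square g" using K33_drawingD(4)[OF D, of 1 0] unfolding square_def by auto
    ultimately show False using inside_no_overlap by blast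
  next
    case 2
    have "A 0 \<in> inside (path_image (\<Theta> 1) \<union> path_image (\<Theta> 2))"
      by (rule connected_inside[OF con[of 0] _ _ _ 2]) (use ends[of 0] arc2[of 0 1] arc2[of 0 2] in auto)
    then have "A 0 \<in> inside (square g)" using sub by blast
    moreover have "A 0 \<in> square g" using K33_drawingD(4)[OF D, of 0 0] unfolding square_def by auto
    ultimately show False using inside_no_overlap by blast
  qed
qed

section \<open>Reduction to the inside case by inversion\<close>

lemma connected_arc_minus_finish:
  assumes "arc g"
  shows "connected (path_image g - {pathfinish g})"
proof -
  have inj: "inj_on g {0..1}" and cont: "continuous_on {0..1} g" using assms by (auto simp: arc_def path_def)
  have "path_image g - {pathfinish g} = g ` {0..<1}"
  proof -
    have "g u \<noteq> g 1" if "u \<in> {0..<1}" for u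
      using inj_onD[OF inj, of u 1] that by auto
    moreover have "{0..1} = insert 1 {0..<1::real}" by auto
    ultimately show ?thesis unfolding path_image_def pathfinish_def by auto
  qed
  moreover have "connected (g ` {0..<1})"
    by (rule connected_continuous_image) (auto intro: continuous_on_subset[OF cont])
  ultimately show ?thesis by simp
qed

lemma connected_arc_minus_start:
  assumes "arc g"
  shows "connected (path_image g - {pathstart g})"
  using connected_arc_minus_finish[of "reversepath g"] assms by (simp add: arc_reversepath)

text \<open>Otherwise the image of \<open>c\<close> lies in the outside of the image of
  \<open>J\<close>, which is connected and unbounded. Pulled back, this region is connected and
  misses \<open>J\<close>; it contains \<open>c\<close> and, from its far points, points arbitrarily
  close to \<open>q\<close>. So \<open>c\<close> would be inside \<open>J\<close>.\<close>

lemma inversion_inside: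
  fixes J :: "complex set"
  assumes J: "compact J" and q: "q \<in> inside J" and c: "c \<in> outside J"
  shows "inverse (c - q) \<in> inside ((\<lambda>w. inverse (w - q)) ` J)"
proof (rule ccontr)
  let ?f = "\<lambda>w. inverse (w - q)" and ?h = "\<lambda>w. inverse w + q"
  assume neg: "?f c \<notin> inside (?f ` J)"
  have qJ: "q \<notin> J" using q inside_no_overlap by blast
  have cJ: "c \<notin> J" using c outside_no_overlap by blast
  have cq: "c \<noteq> q" using c q inside_Int_outside by blast
  have "?f c \<notin> ?f ` J" using cJ by auto
  then have fc: "?f c \<in> outside (?f ` J)" using neg inside_Un_outside[of "?f ` J"] by blast
  have "continuous_on J ?f" using qJ by (intro continuous_intros) auto
  then have cf: "compact (?f ` J)" using J compact_continuous_image by blast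
  \<comment> \<open>The point 0 stands for infinity and has to go, as \<open>inverse\<close> is not
    continuous there; in the plane its removal keeps an open set connected.\<close>
  have con: "connected (outside (?f ` J) - {0})"
    by (rule connected_open_delete) (use cf in \<open>auto intro!: open_outside compact_imp_closed connected_outside compact_imp_bounded\<close>)
  define S where "S = ?h ` (outside (?f ` J) - {0})"
  have conS: "connected S" unfolding S_def
    by (rule connected_continuous_image[OF _ con]) (auto intro!: continuous_intros)
  have SJ: "S \<inter> J = {}"
  proof -
    have "w \<in> ?f ` J" if "?h w \<in> J" for w
      by (rule image_eqI[OF _ that]) simp
    then show ?thesis unfolding S_def using outside_no_overlap by blast
  qed
  have "c \<in> S" unfolding S_def by (rule image_eqI[of _ _ "?f c"]) (use fc cq in auto)
  have "open (inside J)" using J compact_imp_closed open_inside by blast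
  then obtain e where e: "e > 0" "ball q e \<subseteq> inside J" using q open_contains_ball by blast
  have "bounded (- outside (?f ` J))" using cobounded_outside compact_imp_bounded cf by blast
  then obtain M where M: "\<And>w. w \<notin> outside (?f ` J) \<Longrightarrow> norm w \<le> M" unfolding bounded_iff by auto
  \<comment> \<open>Norm above \<open>M\<close> places the point in the outside, norm above
    \<open>1 / e\<close> places its preimage within \<open>e\<close> of \<open>q\<close>.\<close>
  define r where "r = max M (1 / e) + 1"
  have r: "r > M" "r > 1 / e" "r > 0" using e unfolding r_def by (auto simp: max_def add_pos_pos intro: add_pos_pos less_trans[of 0 "1/e"])
  define w where "w = complex_of_real r"
  have nw: "norm w = r" using r by (simp add: w_def)
  have "w \<in> outside (?f ` J)" using M[of w] nw r by force
  then have "?h w \<in> S" unfolding S_def using nw r by auto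
  moreover have "dist q (?h w) < e"
  proof -
    have "dist q (?h w) = 1 / r" by (simp add: dist_norm norm_inverse nw divide_inverse)
    also have "\<dots> < e" using r e by (simp add: field_simps)
    finally show ?thesis .
  qed
  then have "?h w \<in> inside J" using e by auto
  ultimately have "c \<in> inside J" using connected_inside[OF conS SJ] \<open>c \<in> S\<close> by blast
  then show False using c inside_Int_outside by blast
qed

text \<open>If \<open>A 2\<close> lies outside the quadrilateral, an inversion centred inside moves it to the inside.\<close>

lemma no_K33_drawing: "\<not> K33_drawing A B g"
proof
  assume D: "K33_drawing A B g"
  note d = K33_drawingD[OF D]
  define J where "J = square g"
  have cJ: "compact J"
    unfolding J_def square_def by (intro compact_Un compact_path_image arc_imp_path d) auto
  have "inside J \<noteq> {}"
  proof -
    define \<Theta> where "\<Theta> i = reversepath (g i 0) +++ g i 1" for i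
    note th = K33_theta_arc[OF D, folded \<Theta>_def]
    have im: "path_image (\<Theta> 0) \<inter> path_image (\<Theta> 1) = {B 0, B 1}"
      using K33_theta_Int[OF D, of 0 1] th(4)[of 0] th(4)[of 1] by simp
    have "simple_path (\<Theta> 0 +++ reversepath (\<Theta> 1))"
      by (rule simple_path_join_loop) (use th[of 0] th[of 1] im in \<open>auto simp: arc_reversepath\<close>)
    then have "inside (path_image (\<Theta> 0 +++ reversepath (\<Theta> 1))) \<noteq> {}"
      using Jordan_inside_outside[of "\<Theta> 0 +++ reversepath (\<Theta> 1)"] th[of 0] th[of 1] by auto
    moreover have "path_image (\<Theta> 0 +++ reversepath (\<Theta> 1)) = J"
      using th[of 0] th[of 1] unfolding J_def square_def by (subst path_image_join) auto
    ultimately show ?thesis by simp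
  qed
  then obtain q where q: "q \<in> inside J" by blast
  have int: "i = i' \<and> w = A i \<or> j = j' \<and> w = B j"
    if "w \<in> path_image (g i j)" "w \<in> path_image (g i' j')" "i < 3" "j < 3" "i' < 3" "j' < 3" "(i, j) \<noteq> (i', j')" for w i j i' j'
    using K33_drawing_Int[OF D that(3-7,1,2)] .
  have dst: "A i \<noteq> B j" if "i < 3" "j < 3" for i j
    using K33_drawing_distinct(1)[OF D that] .
  have Jm: "\<exists>i' j'. i' < 2 \<and> j' < 2 \<and> w \<in> path_image (g i' j')" if "w \<in> J" for w
    using that unfolding J_def square_def by (metis Un_iff one_less_numeral_iff pos2 semiring_norm(76))
  have JI: "path_image (g i j) \<subseteq> J" if "i < 2" "j < 2" for i j
    using that unfolding J_def square_def by (auto simp: less_2_cases_iff)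
  have meet: "i < 2 \<and> w = A i \<or> j < 2 \<and> w = B j"
    if ij: "i < 3" "j < 3" "i = 2 \<or> j = 2" and w: "w \<in> path_image (g i j)" "w \<in> J" for i j w
  proof -
    obtain i' j' where "i' < 2" "j' < 2" "w \<in> path_image (g i' j')" using Jm[OF w(2)] by blast
    then show ?thesis using int[OF w(1), of i' j'] ij by auto
  qed
  have A2J: "A 2 \<notin> J" using meet[of 2 2 "A 2"] d(4)[of 2 2] by auto
  have out: "A 2 \<in> outside J"
    using K33_not_inside[OF D] A2J inside_Un_outside[of J] unfolding J_def by blast
  have con_out: "T \<inter> inside J = {}" if "connected T" "T \<inter> J = {}" "u \<in> T" "u \<in> outside J" for T u
    using connected_inside[OF that(1,2) _ that(3)] that(4) inside_Int_outside by blast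
  have c22: "path_image (g 2 2) \<inter> inside J = {}" "path_image (g 2 2) \<inter> J = {}"
  proof -
    show e: "path_image (g 2 2) \<inter> J = {}" using meet[of 2 2] by auto
    show "path_image (g 2 2) \<inter> inside J = {}"
      by (rule con_out[OF _ e _ out]) (use d[of 2 2] connected_arc_image in auto)
  qed
  have B2: "B 2 \<in> outside J" 
  proof -
    have "B 2 \<in> path_image (g 2 2)" using d(5)[of 2 2] by simp
    then show ?thesis using c22 inside_Un_outside[of J] by blast
  qed
  \<comment> \<open>The inversion is continuous along the drawing only if \<open>q\<close> is on no
    arc. The arcs outside the quadrilateral's own four contain \<open>A 2\<close> or
    \<open>B 2\<close>, both in the outside of \<open>J\<close>, and touch \<open>J\<close> at most
    in their other end.\<close>
  have qg: "q \<notin> path_image (g i j)" if ij: "i < 3" "j < 3" for i j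
  proof
    assume qi: "q \<in> path_image (g i j)"
    have qJ: "q \<notin> J" using q inside_no_overlap by blast
    consider "i < 2" "j < 2" | "i = 2" "j = 2" | "i = 2" "j < 2" | "i < 2" "j = 2" using ij by linarith
    then show False
    proof cases
      case 1 then show False using JI qi qJ by blast
    next
      case 2 then show False using c22 q qi by blast
    next
      case 3
      have "(path_image (g i j) - {pathfinish (g i j)}) \<inter> inside J = {}"
      proof (rule con_out[OF connected_arc_minus_finish _ _ out])
        show "arc (g i j)" using d ij by blast
        show "(path_image (g i j) - {pathfinish (g i j)}) \<inter> J = {}"
          using meet[of i j] 3 d(3)[OF ij] by auto
        show "A 2 \<in> path_image (g i j) - {pathfinish (g i j)}"
          using d(3,4)[OF ij] 3 dst[of 2 j] by auto
      qed
      moreover have "q \<noteq> pathfinish (g i j)"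
        using JI[of 0 j] d(5)[of 0 j] d(3)[OF ij] 3 qJ by auto
      ultimately show False using q qi by blast
    next
      case 4
      have "(path_image (g i j) - {pathstart (g i j)}) \<inter> inside J = {}"
      proof (rule con_out[OF connected_arc_minus_start _ _ B2])
        show "arc (g i j)" using d ij by blast
        show "(path_image (g i j) - {pathstart (g i j)}) \<inter> J = {}"
          using meet[of i j] 4 d(2)[OF ij] by auto
        show "B 2 \<in> path_image (g i j) - {pathstart (g i j)}"
          using d(2,5)[OF ij] 4 dst[of i 2] by auto
      qed
      moreover have "q \<noteq> pathstart (g i j)"
        using JI[of i 0] d(4)[of i 0] d(2)[OF ij] 4 qJ by auto
      ultimately show False using q qi by blast
    qed
  qed
  define f where "f = (\<lambda>w. inverse (w - q))"
  have finj: "inj f" unfolding f_def by (auto simp: inj_def)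
  have "K33_drawing (f \<circ> A) (f \<circ> B) (\<lambda>i j. f \<circ> g i j)"
    unfolding K33_drawing_def
  proof (intro conjI allI impI)
    fix i j :: nat assume ij: "i < 3" "j < 3"
    have cont: "continuous_on (path_image (g i j)) f"
      unfolding f_def using qg[OF ij] by (intro continuous_intros) auto
    have "path (f \<circ> g i j)"
      using path_continuous_image[OF arc_imp_path[OF d(1)[OF ij]] cont] .
    moreover have "inj_on (f \<circ> g i j) {0..1}"
      using d(1)[OF ij] finj unfolding arc_def by (meson comp_inj_on inj_on_subset subset_UNIV)
    ultimately show "arc (f \<circ> g i j)" by (simp add: arc_def)
    show "pathstart (f \<circ> g i j) = (f \<circ> A) i" "pathfinish (f \<circ> g i j) = (f \<circ> B) j"
      using d(2,3)[OF ij] by (auto simp: pathstart_compose pathfinish_compose)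
    fix i' j' :: nat assume ij': "i' < 3" "j' < 3" "(i, j) \<noteq> (i', j')"
    have "path_image (f \<circ> g i j) \<inter> path_image (f \<circ> g i' j') = f ` (path_image (g i j) \<inter> path_image (g i' j'))"
      unfolding path_image_compose using finj by (simp add: image_Int)
    then show "path_image (f \<circ> g i j) \<inter> path_image (f \<circ> g i' j') \<subseteq>
      (if i = i' then {(f \<circ> A) i} else {}) \<union> (if j = j' then {(f \<circ> B) j} else {})"
      using int[of _ i j i' j'] ij ij' by auto
  qed
  moreover have "(f \<circ> A) 2 \<in> inside (square (\<lambda>i j. f \<circ> g i j))"
  proof -
    have "square (\<lambda>i j. f \<circ> g i j) = f ` J"
      unfolding square_def J_def path_image_compose by (simp only: image_Un)
    then show ?thesis using inversion_inside[OF cJ q out] unfolding f_def by simp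
  qed
  ultimately show False by (rule K33_not_inside)
qed

lemma planar_no_K33:
  fixes V :: "'a set"
  assumes pl: "planar V E"
  shows "no_K33 E"
  unfolding no_K33_def
proof
  assume "\<exists>C x y z. card C = 3 \<and> x \<noteq> y \<and> x \<noteq> z \<and> y \<noteq> z \<and> (\<forall>c\<in>C. {x, c} \<in> E \<and> {y, c} \<in> E \<and> {z, c} \<in> E)"
  then obtain C x y z where C: "card C = 3" and xyz: "x \<noteq> y" "x \<noteq> z" "y \<noteq> z"
    and edge: "\<And>c. c \<in> C \<Longrightarrow> {x, c} \<in> E \<and> {y, c} \<in> E \<and> {z, c} \<in> E" by blast
  obtain c0 c1 c2 where c: "C = {c0, c1, c2}" "c0 \<noteq> c1" "c0 \<noteq> c2" "c1 \<noteq> c2" using C by (auto simp: card_3_iff)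
  obtain p :: "'a \<Rightarrow> complex" and \<gamma> where
    arcs': "\<forall>e\<in>E. arc (\<gamma> e) \<and> {pathstart (\<gamma> e), pathfinish (\<gamma> e)} = p ` e"
    and int': "\<forall>e\<in>E. \<forall>e'\<in>E. e \<noteq> e' \<longrightarrow> path_image (\<gamma> e) \<inter> path_image (\<gamma> e') \<subseteq> p ` (e \<inter> e')"
    using pl unfolding planar_def by (elim exE conjE) (rule that)
  have arcs: "arc (\<gamma> e) \<and> {pathstart (\<gamma> e), pathfinish (\<gamma> e)} = p ` e" if "e \<in> E" for e
    using arcs' that by blast
  have int: "path_image (\<gamma> e) \<inter> path_image (\<gamma> e') \<subseteq> p ` (e \<inter> e')" if "e \<in> E" "e' \<in> E" "e \<noteq> e'" for e e'
    using int' that by blast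
  define a where "a = (\<lambda>i::nat. if i = 0 then x else if i = 1 then y else z)"
  define b where "b = (\<lambda>j::nat. if j = 0 then c0 else if j = 1 then c1 else c2)"
  have E: "{a i, b j} \<in> E" for i j using edge c unfolding a_def b_def by auto
  have ai: "a i = a i' \<Longrightarrow> i = i'" if "i < 3" "i' < 3" for i i'
    using that xyz unfolding a_def by (auto split: if_splits)
  have bi: "b j = b j' \<Longrightarrow> j = j'" if "j < 3" "j' < 3" for j j'
    using that c unfolding b_def by (auto split: if_splits)
  \<comment> \<open>If the two sides shared a vertex, some edge would be a singleton and its arc
    would be closed.\<close>
  have ab: "a i \<noteq> b j" for i j
  proof
    assume "a i = b j"
    then have "{pathstart (\<gamma> {a i, b j}), pathfinish (\<gamma> {a i, b j})} = {p (a i)}" "arc (\<gamma> {a i, b j})"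
      using arcs[OF E[of i j]] by auto
    then show False using arc_distinct_ends by (metis insertI1 insert_commute singletonD)
  qed
  \<comment> \<open>The arc of an edge may run in either direction; here all are turned to start at
    the \<open>a\<close> side.\<close>
  define g where "g = (\<lambda>i j. if pathstart (\<gamma> {a i, b j}) = p (a i) then \<gamma> {a i, b j} else reversepath (\<gamma> {a i, b j}))"
  have "K33_drawing (p \<circ> a) (p \<circ> b) g"
    unfolding K33_drawing_def
  proof (intro conjI allI impI)
    fix i j :: nat assume ij: "i < 3" "j < 3"
    let ?e = "{a i, b j}"
    have ar: "arc (\<gamma> ?e)" and en: "{pathstart (\<gamma> ?e), pathfinish (\<gamma> ?e)} = {p (a i), p (b j)}"
      using arcs[OF E[of i j]] by auto
    show "arc (g i j)" using ar unfolding g_def by (simp add: arc_reversepath)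
    show "pathstart (g i j) = (p \<circ> a) i" "pathfinish (g i j) = (p \<circ> b) j"
      using en unfolding g_def by (auto simp: doubleton_eq_iff)
    fix i' j' :: nat assume ij': "i' < 3" "j' < 3" "(i, j) \<noteq> (i', j')"
    have ne: "?e \<noteq> {a i', b j'}" using ai[OF ij(1) ij'(1)] bi[OF ij(2) ij'(2)] ab[of i j'] ij'(3)
      unfolding doubleton_eq_iff by blast
    have "path_image (g i j) = path_image (\<gamma> ?e)" "path_image (g i' j') = path_image (\<gamma> {a i', b j'})"
      unfolding g_def by auto
    then have "path_image (g i j) \<inter> path_image (g i' j') \<subseteq> p ` (?e \<inter> {a i', b j'})"
      using int[OF E E ne] by simp
    also have "\<dots> \<subseteq> (if i = i' then {(p \<circ> a) i} else {}) \<union> (if j = j' then {(p \<circ> b) j} else {})"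
    proof (rule image_subsetI)
      fix w assume "w \<in> ?e \<inter> {a i', b j'}"
      then have "w = a i \<or> w = b j" "w = a i' \<or> w = b j'" by blast+
      then have "w = a i \<and> i = i' \<or> w = b j \<and> j = j'"
        using ai[OF ij(1) ij'(1)] bi[OF ij(2) ij'(2)] ab[of i j'] ab[of i' j] by metis
      then show "p w \<in> (if i = i' then {(p \<circ> a) i} else {}) \<union> (if j = j' then {(p \<circ> b) j} else {})" by auto
    qed
    finally show "path_image (g i j) \<inter> path_image (g i' j') \<subseteq>
      (if i = i' then {(p \<circ> a) i} else {}) \<union> (if j = j' then {(p \<circ> b) j} else {})" .
  qed
  then show False using no_K33_drawing by blast
qed

theorem theorem6:
  fixes V :: "'a set" and E :: "'a set set"
  assumes "planar_ktree 3 V E"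
  shows "track_number V E \<le> 25"
  using assms track_number_le_25 planar_no_K33 unfolding planar_ktree_def by blast

end
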